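(* For arbitrary $a\in\mathbb{R}\setminus\mathbb{Z}$ and $p\in\mathbb{N}$, the embeddings in the Colombeau algebra $\mathcal{G}(\mathbb{R})$ of the distributions $\nu_{\pm}^{a}$ and $\nu_{\pm}^{-a-p-1}$ on $\mathbb{R}$ satisfy $$(-1)^p\,\widetilde{\nu_{+}^{a}}\cdot\widetilde{\nu_{-}^{-a-p-1}}\;+\;\widetilde{\nu_{-}^{a}}\cdot\widetilde{\nu_{+}^{-a-p-1}}\;\approx\;\binom{a+p}{p}\,\delta^{(p)}.$$ That is, the generalized function on the left-hand side admits the distribution on the right-hand side as associated distribution.
   Context: $\mathbb{N}=\{1,2,\dots\}$, $\mathbb{N}_0=\mathbb{N}\cup\{0\}$; $\mathcal{D}(\mathbb{R})$ is the space of smooth compactly supported test functions, $\mathcal{D}'(\mathbb{R})$ the space of distributions, $\delta$ the Dirac distribution at $0$, and $\delta^{(p)}$ its $p$-th distributional derivative. For $x\in\mathbb{R}$ and $n\in\mathbb{N}$, $\binom{x}{n}=\frac{x(x-1)\cdots(x-n+1)}{n!}$. **Colombeau algebra.** For $q\in\mathbb{N}_0$ put $A_q(\mathbb{R})=\{\varphi\in\mathcal{D}(\mathbb{R}):\int_{\mathbb{R}}x^j\varphi(x)\,dx=\delta_{0j},\ j=0,1,\dots,q\}$, where $\delta_{0j}=1$ if $j=0$ and $0$ otherwise. For $\varphi\in A_q(\mathbb{R})$ and $\varepsilon>0$ put $\varphi_\varepsilon(x)=\varepsilon^{-1}\varphi(\varepsilon^{-1}x)$ and $\check\varphi(x)=\varphi(-x)$.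 Let $\mathcal{E}[\mathbb{R}]$ be the algebra (pointwise operations) of functions $f(\varphi,x):A_0(\mathbb{R})\times\mathbb{R}\to\mathbb{C}$ that are infinitely differentiable in $x$ for each fixed $\varphi$. Let $\mathcal{E}_M[\mathbb{R}]$ be the subalgebra of those $f$ such that for each compact $K\subset\mathbb{R}$ and $m\in\mathbb{N}_0$ there is $q\in\mathbb{N}$ such that for each $\varphi\in A_q(\mathbb{R})$, $\sup_{x\in K}|\partial_x^m f(\varphi_\varepsilon,x)|=O(\varepsilon^{-q})$ as $\varepsilon\to0_+$. Let $\mathcal{I}[\mathbb{R}]$ be the ideal of $\mathcal{E}_M[\mathbb{R}]$ of those $f$ such that for each compact $K\subset\mathbb{R}$ and $m\in\mathbb{N}_0$ there is $q\in\mathbb{N}$ such that for every $r\ge q$ and $\varphi\in A_r(\mathbb{R})$, $\sup_{x\in K}|\partial_x^m f(\varphi_\varepsilon,x)|=O(\varepsilon^{r-q})$ as $\varepsilon\to0_+$. Then $\mathcal{G}(\mathbb{R})=\mathcal{E}_M[\mathbb{R}]/\mathcal{I}[\mathbb{R}]$. **Embedding.** A distribution $u\in\mathcal{D}'(\mathbb{R})$ is embedded in $\mathcal{G}(\mathbb{R})$ as the class $\widetilde{u}$ of the representative $\widetilde{u}(\varphi,x)=(u*\check\varphi)(x)$. Products of embedded distributions are taken in $\mathcal{G}(\mathbb{R})$. **Association.** A generalized function $f\in\mathcal{G}(\mathbb{R})$ admits $u\in\mathcal{D}'(\mathbb{R})$ as associated distribution, written $f\approx u$, if for some representative $f(\varphi,x)$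 of $f$ and any $\psi\in\mathcal{D}(\mathbb{R})$ there is $q\in\mathbb{N}_0$ such that for any $\varphi\in A_q(\mathbb{R})$, $\lim_{\varepsilon\to0_+}\int_{\mathbb{R}}f(\varphi_\varepsilon,x)\psi(x)\,dx=\langle u,\psi\rangle$. (This does not depend on the representative.) **The distributions $\nu_\pm^a$.** For real $a>-1$, $\nu_+^a(x)=x^a/\Gamma(a+1)$ if $x>0$ and $0$ if $x<0$; $\nu_-^a(x)=(-x)^a/\Gamma(a+1)$ if $x<0$ and $0$ if $x>0$ (locally integrable functions). For arbitrary $a\in\mathbb{R}\setminus\{-1,-2,\dots\}$, $\nu_+^a=\partial_x^r\nu_+^{a+r}$ and $\nu_-^a=(-1)^r\partial_x^r\nu_-^{a+r}$, where $r\in\mathbb{N}_0$ is such that $a+r>-1$ and derivatives are in the distributional sense. *)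

theory Defs
  imports "HOL-Analysis.Analysis" "HOL-Library.Landau_Symbols" "HOL-Algebra.QuotRing"
begin

section \<open>Test functions and distributions on the real line\<close>

definition nderiv :: "nat \<Rightarrow> (real \<Rightarrow> complex) \<Rightarrow> real \<Rightarrow> complex" where
  "nderiv m f = ((\<lambda>g x. vector_derivative g (at x)) ^^ m) f"

definition smooth :: "(real \<Rightarrow> complex) \<Rightarrow> bool" where
  "smooth f \<longleftrightarrow> (\<forall>m x. nderiv m f differentiable (at x))"

definition supp :: "(real \<Rightarrow> complex) \<Rightarrow> real set" where
  "supp f = closure {x. f x \<noteq> 0}"

definition test_functions :: "(real \<Rightarrow> complex) set" where
  "test_functions = {\<phi>. smooth \<phi> \<and> compact (supp \<phi>)}"

text \<open>Distributions are the complex-linear functionals on test functions satisfying the usual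
  seminorm estimates on every compact set. A functional is an HOL function on all of
  \<^typ>\<open>real \<Rightarrow> complex\<close>; its values outside \<open>test_functions\<close> are irrelevant.\<close>

type_synonym functional = "(real \<Rightarrow> complex) \<Rightarrow> complex"

definition distributions :: "functional set" where
  "distributions = {u.
     (\<forall>\<phi>\<in>test_functions. \<forall>\<psi>\<in>test_functions. u (\<lambda>x. \<phi> x + \<psi> x) = u \<phi> + u \<psi>) \<and>
     (\<forall>c. \<forall>\<phi>\<in>test_functions. u (\<lambda>x. c * \<phi> x) = c * u \<phi>) \<and>
     (\<forall>K. compact K \<longrightarrow> (\<exists>C N. \<forall>\<phi>\<in>test_functions. supp \<phi> \<subseteq> K \<longrightarrow>
        norm (u \<phi>) \<le> C * (\<Sum>m\<le>N. SUP x. norm (nderiv m \<phi> x))))}"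

definition dist_deriv :: "functional \<Rightarrow> functional" where
  "dist_deriv u = (\<lambda>\<psi>. - u (nderiv 1 \<psi>))"

definition dirac :: functional where
  "dirac = (\<lambda>\<psi>. \<psi> 0)"

definition regular_dist :: "(real \<Rightarrow> real) \<Rightarrow> functional" where
  "regular_dist f = (\<lambda>\<psi>. \<integral>x. complex_of_real (f x) * \<psi> x \<partial>lborel)"

definition dist_convolution :: "functional \<Rightarrow> (real \<Rightarrow> complex) \<Rightarrow> real \<Rightarrow> complex" where
  "dist_convolution u \<theta> = (\<lambda>x. u (\<lambda>y. \<theta> (x - y)))"


section \<open>The distributions \<open>\<nu>\<^sub>\<plusminus>\<^sup>a\<close>\<close>

definition nu_plus_fun :: "real \<Rightarrow> real \<Rightarrow> real" where
  "nu_plus_fun a x = (if x > 0 then x powr a / Gamma (a + 1) else 0)"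

definition nu_minus_fun :: "real \<Rightarrow> real \<Rightarrow> real" where
  "nu_minus_fun a x = (if x < 0 then (- x) powr a / Gamma (a + 1) else 0)"

text \<open>The number of derivatives used in the definition of \<open>\<nu>\<^sub>\<plusminus>\<^sup>a\<close>. Any \<open>r\<close> with \<open>a + r > -1\<close> gives the
  same distribution; the least one makes \<open>\<nu>\<^sub>\<plusminus>\<^sup>a\<close> the locally integrable function itself (\<open>r = 0\<close>)
  if \<open>a > -1\<close>. The definitions are only meaningful for \<open>a \<notin> {-1, -2, \<dots>}\<close>.\<close>

definition nu_order :: "real \<Rightarrow> nat" where
  "nu_order a = (LEAST r. a + real r > -1)"

definition nu_plus :: "real \<Rightarrow> functional" where
  "nu_plus a = (dist_deriv ^^ nu_order a) (regular_dist (nu_plus_fun (a + real (nu_order a))))"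

definition nu_minus :: "real \<Rightarrow> functional" where
  "nu_minus a = (\<lambda>\<psi>. (-1) ^ nu_order a *
     (dist_deriv ^^ nu_order a) (regular_dist (nu_minus_fun (a + real (nu_order a)))) \<psi>)"


section \<open>The Colombeau algebra\<close>

definition A_space :: "nat \<Rightarrow> (real \<Rightarrow> complex) set" where
  "A_space q = {\<phi>\<in>test_functions. \<forall>j\<le>q.
     (\<integral>x. complex_of_real (x ^ j) * \<phi> x \<partial>lborel) = (if j = 0 then 1 else 0)}"

definition rescale :: "real \<Rightarrow> (real \<Rightarrow> complex) \<Rightarrow> real \<Rightarrow> complex" where
  "rescale \<epsilon> \<phi> = (\<lambda>x. complex_of_real (1 / \<epsilon>) * \<phi> (x / \<epsilon>))"

text \<open>Elements of \<open>\<E>[\<real>]\<close> are HOL functions whose first argument ranges over all functions; only the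
  values on \<open>A_space 0\<close> are constrained. Two functions agreeing on \<open>A_space 0\<close> differ by an
  element of the ideal below, so the quotient is unaffected by the other values.\<close>

type_synonym representative = "(real \<Rightarrow> complex) \<Rightarrow> real \<Rightarrow> complex"

definition E_space :: "representative set" where
  "E_space = {f. \<forall>\<phi>\<in>A_space 0. smooth (f \<phi>)}"

text \<open>Compact sets are required to be nonempty only because the supremum of the empty set of reals
  is unspecified.\<close>

definition E_moderate :: "representative set" where
  "E_moderate = {f\<in>E_space. \<forall>K m. compact K \<and> K \<noteq> {} \<longrightarrow>
     (\<exists>q\<ge>1. \<forall>\<phi>\<in>A_space q.
        (\<lambda>\<epsilon>. SUP x\<in>K. norm (nderiv m (f (rescale \<epsilon> \<phi>)) x))
          \<in> O[at_right 0](\<lambda>\<epsilon>. 1 / \<epsilon> ^ q))}"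

definition E_null :: "representative set" where
  "E_null = {f\<in>E_moderate. \<forall>K m. compact K \<and> K \<noteq> {} \<longrightarrow>
     (\<exists>q\<ge>1. \<forall>r\<ge>q. \<forall>\<phi>\<in>A_space r.
        (\<lambda>\<epsilon>. SUP x\<in>K. norm (nderiv m (f (rescale \<epsilon> \<phi>)) x))
          \<in> O[at_right 0](\<lambda>\<epsilon>. \<epsilon> ^ (r - q)))}"

definition moderate_ring :: "representative ring" where
  "moderate_ring = \<lparr>carrier = E_moderate,
     mult = (\<lambda>f g \<phi> x. f \<phi> x * g \<phi> x), one = (\<lambda>\<phi> x. 1),
     zero = (\<lambda>\<phi> x. 0), add = (\<lambda>f g \<phi> x. f \<phi> x + g \<phi> x)\<rparr>"

definition colombeau :: "representative set ring" where
  "colombeau = moderate_ring Quot E_null"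

text \<open>The class of \<open>(\<phi>, x) \<mapsto> (u * \<phi>')(x)\<close> with \<open>\<phi>'(y) = \<phi>(-y)\<close>.\<close>

definition colombeau_embed :: "functional \<Rightarrow> representative set" where
  "colombeau_embed u = E_null +>\<^bsub>moderate_ring\<^esub> (\<lambda>\<phi>. dist_convolution u (\<lambda>y. \<phi> (- y)))"

definition associated :: "representative set \<Rightarrow> functional \<Rightarrow> bool" (infix "\<approx>\<^sub>D" 50) where
  "F \<approx>\<^sub>D u \<longleftrightarrow> F \<in> carrier colombeau \<and> u \<in> distributions \<and>
     (\<exists>f\<in>F. \<forall>\<psi>\<in>test_functions. \<exists>q. \<forall>\<phi>\<in>A_space q.
        ((\<lambda>\<epsilon>. \<integral>x. f (rescale \<epsilon> \<phi>) x * \<psi> x \<partial>lborel) \<longlongrightarrow> u \<psi>) (at_right 0))"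

end

theory Submission
  imports Defs "HOL-Computational_Algebra.Formal_Power_Series"
begin

text \<open>
  Put \<open>b = -a - p - 1\<close>. For a mollifier \<open>\<phi>\<close> let \<open>F\<close> be the value at \<open>\<phi>\<close> of the obvious representative of the
  left-hand side, that is \<open>(-1) ^ p\<close> times the product of the smoothings of \<open>\<nu>\<^sub>+\<^sup>a\<close> and \<open>\<nu>\<^sub>-\<^sup>b\<close>, plus the product of the
  smoothings of \<open>\<nu>\<^sub>-\<^sup>a\<close> and \<open>\<nu>\<^sub>+\<^sup>b\<close>. The distributions are homogeneous, so the value at \<open>\<phi>\<^sub>\<epsilon>\<close> is
  \<open>\<epsilon> ^ -(p + 1) * F (x / \<epsilon>)\<close> (lemma \<open>corr_rescale\<close>), and \<open>F\<close> has compact support because in each product one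
  factor vanishes far to the left and the other far to the right. By a Taylor expansion of the test function
  (lemma \<open>rescaled_test_integral_limit\<close>) the theorem therefore says that the moments of \<open>F\<close> of order less than \<open>p\<close>
  vanish and that the \<open>p\<close>-th one is \<open>(-1) ^ p * p!\<close> times the binomial coefficient.

  To compute the moments, write the distributions as derivatives, of orders \<open>r\<close> and \<open>s\<close>, of the locally integrable
  functions with exponents \<open>a + r\<close> and \<open>b + s\<close>, and move the derivatives to \<open>\<phi>\<close>. A moment of \<open>F\<close> becomes a triple integral
  in which the variable \<open>t\<close> of \<open>F\<close> can be integrated first (lemma \<open>moment_corr_mult\<close>). This is a beta integral (lemma
  \<open>nu_convolution\<close>): the first product yields the functions \<open>(u - v)\<^sub>+ ^ (n + k) / (n + k)!\<close> with \<open>n = r + s - p\<close>, the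
  second one yields their mirror images. With the sign \<open>(-1) ^ p\<close> the two halves glue together to the
  polynomials \<open>(u - v) ^ (n + k) / (n + k)!\<close> (lemma \<open>kernel_glue\<close>). What remains is a polynomial in \<open>(u, v)\<close>,
  homogeneous of degree \<open>r + s - (p - j)\<close> for the \<open>j\<close>-th moment, integrated against the \<open>r\<close>-th derivative of
  \<open>\<phi>\<close> in \<open>u\<close> and the \<open>s\<close>-th one in \<open>v\<close>. Integration by parts kills it for \<open>j < p\<close>, and for \<open>j = p\<close> leaves only the
  coefficient of \<open>u ^ r * v ^ s\<close>, which Vandermonde's identity evaluates (lemma \<open>moments_of_glued_product\<close>).

  It must also be checked that the objects exist: moderate functions form a ring in which the null functions are an
  ideal, so that classes can be computed on representatives (lemma \<open>colombeau_combination\<close>), and smoothings of locally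
  integrable functions and of their derivatives are moderate (lemma \<open>corr_moderate\<close>).
\<close>

section \<open>Iterated derivatives of smooth functions\<close>

lemma nderiv_0 [simp]: "nderiv 0 f = f"
  by (simp add: nderiv_def)

lemma nderiv_Suc: "nderiv (Suc m) f x = vector_derivative (nderiv m f) (at x)"
  by (simp add: nderiv_def)

lemma nderiv_nderiv: "nderiv m (nderiv k f) = nderiv (m + k) f"
  by (simp add: nderiv_def funpow_add)

lemma smooth_has_vector_derivative:
  assumes "smooth f"
  shows "(nderiv m f has_vector_derivative nderiv (Suc m) f x) (at x)"
  using assms unfolding nderiv_Suc smooth_def
  by (simp add: vector_derivative_works)

lemma smooth_continuous: "smooth f \<Longrightarrow> continuous_on S (nderiv m f)"
  by (intro continuous_at_imp_continuous_on ballI)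
    (rule has_vector_derivative_continuous[OF smooth_has_vector_derivative])

text \<open>Iterated derivatives are always computed by guessing all of them at once: a sequence in which each
function is differentiable with the next one as derivative lists the derivatives of its first term.\<close>

lemma derivative_sequence:
  assumes "\<And>m x. (G m has_vector_derivative G (Suc m) x) (at x)"
  shows "nderiv m (G 0) = G m"
    and smooth_derivative_sequence: "smooth (G 0)"
proof -
  have *: "nderiv m (G 0) = G m" for m
  proof (induction m)
    case (Suc m)
    show ?case
      by (rule ext) (simp add: nderiv_Suc Suc vector_derivative_at[OF assms])
  qed simp
  show "nderiv m (G 0) = G m" by (rule *)
  show "smooth (G 0)"
    unfolding smooth_def * using assms differentiableI_vector by blast
qed

lemma smooth_nderiv: "smooth f \<Longrightarrow> smooth (nderiv k f)"
  by (simp add: smooth_def nderiv_nderiv)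

lemma
  assumes "smooth f" "smooth g"
  shows smooth_add: "smooth (\<lambda>x. f x + g x)"
    and nderiv_add: "nderiv m (\<lambda>x. f x + g x) = (\<lambda>x. nderiv m f x + nderiv m g x)"
proof -
  have "((\<lambda>x. nderiv m f x + nderiv m g x) has_vector_derivative
      (nderiv (Suc m) f x + nderiv (Suc m) g x)) (at x)" for m x
    by (intro has_vector_derivative_add smooth_has_vector_derivative assms)
  from derivative_sequence[of "\<lambda>m x. nderiv m f x + nderiv m g x", OF this]
  show "smooth (\<lambda>x. f x + g x)" "nderiv m (\<lambda>x. f x + g x) = (\<lambda>x. nderiv m f x + nderiv m g x)"
    by simp_all
qed

lemma
  assumes "smooth f"
  shows smooth_cmult: "smooth (\<lambda>x. c * f x)"
    and nderiv_cmult: "nderiv m (\<lambda>x. c * f x) = (\<lambda>x. c * nderiv m f x)"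
proof -
  have "((\<lambda>x. c * nderiv m f x) has_vector_derivative (c * nderiv (Suc m) f x)) (at x)" for m x
    by (intro has_vector_derivative_mult_right smooth_has_vector_derivative assms)
  from derivative_sequence[of "\<lambda>m x. c * nderiv m f x", OF this]
  show "smooth (\<lambda>x. c * f x)" "nderiv m (\<lambda>x. c * f x) = (\<lambda>x. c * nderiv m f x)"
    by simp_all
qed

lemma
  assumes "smooth f"
  shows smooth_affine: "smooth (\<lambda>x. f (c * x + d))"
    and nderiv_affine: "nderiv m (\<lambda>x. f (c * x + d)) = (\<lambda>x. of_real (c ^ m) * nderiv m f (c * x + d))"
proof -
  have "((\<lambda>x. of_real (c ^ m) * nderiv m f (c * x + d)) has_vector_derivative
       (of_real (c ^ Suc m) * nderiv (Suc m) f (c * x + d))) (at x)" for m x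
  proof -
    have "((\<lambda>x. nderiv m f (c * x + d)) has_vector_derivative c *\<^sub>R nderiv (Suc m) f (c * x + d)) (at x)"
      by (rule vector_diff_chain_at[of "\<lambda>x. c * x + d" c x "nderiv m f", unfolded o_def])
        (auto intro!: derivative_eq_intros smooth_has_vector_derivative assms)
    from has_vector_derivative_mult_right[OF this, of "of_real (c ^ m)"]
    show ?thesis by (simp add: scaleR_conv_of_real algebra_simps)
  qed
  from derivative_sequence[of "\<lambda>m x. of_real (c ^ m) * nderiv m f (c * x + d)", OF this]
  show "smooth (\<lambda>x. f (c * x + d))"
    "nderiv m (\<lambda>x. f (c * x + d)) = (\<lambda>x. of_real (c ^ m) * nderiv m f (c * x + d))"
    by simp_all
qed

lemma
  assumes "smooth f" "smooth g"
  shows smooth_mult: "smooth (\<lambda>x. f x * g x)"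
    and nderiv_mult: "nderiv m (\<lambda>x. f x * g x) =
      (\<lambda>x. \<Sum>i\<le>m. of_nat (m choose i) * (nderiv i f x * nderiv (m - i) g x))"
proof -
  define G where "G m x = (\<Sum>i\<le>m. of_nat (m choose i) * (nderiv i f x * nderiv (m - i) g x))" for m x
  have "(G m has_vector_derivative G (Suc m) x) (at x)" for m x
  proof -
    let ?T = "\<lambda>i k. nderiv i f x * nderiv k g x"
    have "(G m has_vector_derivative
        (\<Sum>i\<le>m. of_nat (m choose i) * (?T i (Suc (m - i)) + ?T (Suc i) (m - i)))) (at x)"
      unfolding G_def
      by (intro has_vector_derivative_sum has_vector_derivative_mult_right has_vector_derivative_mult
            smooth_has_vector_derivative assms)
    also have "(\<Sum>i\<le>m. of_nat (m choose i) * (?T i (Suc (m - i)) + ?T (Suc i) (m - i))) =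
        (\<Sum>i\<le>m. of_nat (m choose i) * ?T i (Suc m - i)) + (\<Sum>i\<le>m. of_nat (m choose i) * ?T (Suc i) (m - i))"
      by (simp add: distrib_left sum.distrib Suc_diff_le)
    also have "(\<Sum>i\<le>m. of_nat (m choose i) * ?T i (Suc m - i)) =
        (\<Sum>i\<le>Suc m. of_nat (m choose i) * ?T i (Suc m - i))"
      by (simp add: binomial_eq_0)
    also have "\<dots> = ?T 0 (Suc m) + (\<Sum>i\<le>m. of_nat (m choose Suc i) * ?T (Suc i) (m - i))"
      by (subst sum.atMost_Suc_shift) simp
    also have "\<dots> + (\<Sum>i\<le>m. of_nat (m choose i) * ?T (Suc i) (m - i)) = G (Suc m) x"
      unfolding G_def by (subst sum.atMost_Suc_shift) (simp add: distrib_right sum.distrib)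
    finally show ?thesis .
  qed
  from derivative_sequence[of G, OF this]
  have "smooth (G 0)" "nderiv m (G 0) = G m" by simp_all
  moreover have "G 0 = (\<lambda>x. f x * g x)" by (simp add: G_def fun_eq_iff)
  ultimately show "smooth (\<lambda>x. f x * g x)" "nderiv m (\<lambda>x. f x * g x) =
      (\<lambda>x. \<Sum>i\<le>m. of_nat (m choose i) * (nderiv i f x * nderiv (m - i) g x))"
    by (simp_all add: G_def fun_eq_iff)
qed

lemma smooth_const: "smooth (\<lambda>x. c)" and nderiv_const: "nderiv (Suc m) (\<lambda>x. c) = (\<lambda>x. 0)"
proof -
  have "((\<lambda>x. if m = 0 then c else 0) has_vector_derivative (if Suc m = 0 then c else 0)) (at x)" for m x
    by (cases m) auto
  from derivative_sequence[of "\<lambda>m x. if m = 0 then c else 0", OF this]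
  show "smooth (\<lambda>x. c)" "nderiv (Suc m) (\<lambda>x. c) = (\<lambda>x. 0)" by (simp_all add: fun_eq_iff)
qed

lemma smooth_power: "smooth (\<lambda>x. of_real x ^ k)"
proof (induction k)
  case (Suc k)
  have "smooth (\<lambda>x. of_real x)"
  proof -
    have "((\<lambda>x. if m = 0 then of_real x else if m = 1 then 1 else (0::complex)) has_vector_derivative
      (if Suc m = 0 then of_real x else if Suc m = 1 then 1 else 0)) (at x)" for m x
    proof (cases m)
      case 0
      then show ?thesis
        using has_vector_derivative_of_real[OF DERIV_ident[of "at x"]] by simp
    qed auto
    from smooth_derivative_sequence[of "\<lambda>m x. if m = 0 then of_real x else if m = 1 then 1 else 0", OF this]
    show ?thesis by simp
  qed
  from smooth_mult[OF this Suc] show ?case by simp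
qed (simp add: smooth_const)

section \<open>Test functions and their moments\<close>

text \<open>The definition of the support by a closure is inconvenient for estimates; for compactly supported
functions it is replaced throughout by vanishing outside some interval \<open>{-R..R}\<close>.\<close>

lemma supp_zero: "supp f \<subseteq> {-R..R} \<longleftrightarrow> (\<forall>x. R < \<bar>x\<bar> \<longrightarrow> f x = 0)"
proof -
  have "supp f \<subseteq> {-R..R} \<longleftrightarrow> {x. f x \<noteq> 0} \<subseteq> {-R..R}"
    unfolding supp_def
    using closure_subset[of "{x. f x \<noteq> 0}"] closure_minimal[of "{x. f x \<noteq> 0}" "{-R..R}"] by auto
  also have "\<dots> \<longleftrightarrow> (\<forall>x. R < \<bar>x\<bar> \<longrightarrow> f x = 0)"
  proof -
    have "x \<in> {-R..R} \<longleftrightarrow> \<not> R < \<bar>x\<bar>" for x by auto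
    then show ?thesis by blast
  qed
  finally show ?thesis .
qed

lemma test_function_iff:
  "f \<in> test_functions \<longleftrightarrow> smooth f \<and> (\<exists>R>0. \<forall>x. R < \<bar>x\<bar> \<longrightarrow> f x = 0)"
proof -
  have "compact (supp f) \<longleftrightarrow> (\<exists>R>0. \<forall>x. R < \<bar>x\<bar> \<longrightarrow> f x = 0)"
  proof
    assume "compact (supp f)"
    then obtain R where "R > 0" "\<And>x. x \<in> supp f \<Longrightarrow> norm x \<le> R"
      using compact_imp_bounded[of "supp f"] unfolding bounded_pos by blast
    moreover have "x \<in> supp f" if "f x \<noteq> 0" for x
      using that closure_subset[of "{x. f x \<noteq> 0}"] unfolding supp_def by auto
    ultimately have "\<forall>x. R < \<bar>x\<bar> \<longrightarrow> f x = 0"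
      unfolding real_norm_def by (meson not_less)
    with \<open>R > 0\<close> show "\<exists>R>0. \<forall>x. R < \<bar>x\<bar> \<longrightarrow> f x = 0" by blast
  next
    assume "\<exists>R>0. \<forall>x. R < \<bar>x\<bar> \<longrightarrow> f x = 0"
    then obtain R where "supp f \<subseteq> {-R..R}" using supp_zero by blast
    then have "supp f = {-R..R} \<inter> supp f" by blast
    then show "compact (supp f)"
      using compact_Int_closed[of "{-R..R}" "supp f"] by (simp add: supp_def)
  qed
  then show ?thesis by (simp add: test_functions_def)
qed

lemma nderiv_outside:
  assumes "\<forall>x. R < \<bar>x\<bar> \<longrightarrow> f x = 0"
  shows "R < \<bar>x\<bar> \<Longrightarrow> nderiv m f x = 0"
proof (induction m arbitrary: x)
  case (Suc m)
  have "open {x. R < \<bar>x\<bar>}"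
    by (intro open_Collect_less continuous_intros)
  then have "(nderiv m f has_vector_derivative 0) (at x)"
    by (rule has_vector_derivative_transform_within_open[OF has_vector_derivative_const[of 0]])
      (use Suc in auto)
  then show ?case by (simp add: nderiv_Suc vector_derivative_at)
qed (use assms in simp)

lemma test_function_smooth: "f \<in> test_functions \<Longrightarrow> smooth f"
  by (simp add: test_functions_def)

lemma test_function_nderiv: "f \<in> test_functions \<Longrightarrow> nderiv k f \<in> test_functions"
  unfolding test_function_iff using smooth_nderiv nderiv_outside by blast

lemma test_function_power_mult: "f \<in> test_functions \<Longrightarrow> (\<lambda>x. of_real x ^ k * f x) \<in> test_functions"
  unfolding test_function_iff by (auto intro: smooth_mult smooth_power)

lemma test_function_bounded:
  assumes "f \<in> test_functions"
  obtains B where "B > 0" "\<And>x. norm (f x) \<le> B"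
proof -
  from assms obtain R where "smooth f" and R: "\<And>x. R < \<bar>x\<bar> \<Longrightarrow> f x = 0"
    by (auto simp: test_function_iff)
  have "compact (f ` {-R..R})"
    using smooth_continuous[OF \<open>smooth f\<close>, of _ 0] by (intro compact_continuous_image) auto
  then obtain B where B: "B > 0" "\<And>x. x \<in> f ` {-R..R} \<Longrightarrow> norm x \<le> B"
    using compact_imp_bounded[of "f ` {-R..R}"] unfolding bounded_pos by blast
  have "norm (f x) \<le> B" for x
  proof (cases "R < \<bar>x\<bar>")
    case False
    then have "x \<in> {-R..R}" by auto
    then show ?thesis using B(2) by blast
  qed (use B R in simp)
  with B(1) that show ?thesis by blast
qed

lemma test_function_measurable: "f \<in> test_functions \<Longrightarrow> f \<in> borel_measurable borel"
  using smooth_continuous[of f UNIV 0] by (intro borel_measurable_continuous_onI) (simp add: test_function_smooth)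

lemma test_function_integrable: 
  assumes "f \<in> test_functions" shows "integrable lborel f"
proof -
  from assms obtain R where R: "\<And>x. R < \<bar>x\<bar> \<Longrightarrow> f x = 0"
    by (auto simp: test_function_iff)
  obtain B where B: "\<And>x. norm (f x) \<le> B" using test_function_bounded[OF assms] by blast
  show ?thesis
  proof (rule integrableI_bounded_set[where A="{-R..R}" and B=B])
    show "AE x in lborel. x \<notin> {-R..R} \<longrightarrow> f x = 0"
      by (rule AE_I2) (auto intro!: R)
  qed (use B test_function_measurable[OF assms] in \<open>auto simp: emeasure_lborel_Icc_eq\<close>)
qed

lemma integral_derivative_test_function:
  assumes "f \<in> test_functions"
  shows "(\<integral>x. nderiv 1 f x \<partial>lborel) = 0"
proof -
  from assms obtain R where "R > 0" and R: "\<And>x. R < \<bar>x\<bar> \<Longrightarrow> f x = 0"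
    by (auto simp: test_function_iff)
  note f = test_function_smooth[OF assms]
  have eq: "indicator {-(R+1)..R+1} x *\<^sub>R nderiv 1 f x = nderiv 1 f x" for x
    using nderiv_outside[of R f x 1] R by (auto simp: indicator_def)
  have "(\<integral>x. indicator {-(R+1)..R+1} x *\<^sub>R nderiv 1 f x \<partial>lborel) = f (R+1) - f (-(R+1))"
    using smooth_has_vector_derivative[OF f, of 0] smooth_continuous[OF f, of _ 1] \<open>R > 0\<close>
    by (intro integral_FTC_atLeastAtMost) (auto intro: has_vector_derivative_at_within)
  also have "\<dots> = 0" using R \<open>R > 0\<close> by simp
  finally show ?thesis unfolding eq .
qed

lemma nderiv_1_power_Suc_mult:
  assumes "smooth f"
  shows "nderiv 1 (\<lambda>x. of_real x ^ Suc k * f x) x =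
      of_real x ^ Suc k * nderiv 1 f x + of_nat (Suc k) * (of_real x ^ k * f x)"
proof -
  have "((\<lambda>x. of_real (x ^ Suc k)) has_vector_derivative (of_real (of_nat (Suc k) * x ^ k)::complex)) (at x)"
    using DERIV_pow[of "Suc k" x] by (intro has_vector_derivative_of_real) simp
  from has_vector_derivative_mult[OF this smooth_has_vector_derivative[OF assms, of 0]]
  have "((\<lambda>x. of_real x ^ Suc k * f x) has_vector_derivative
     (of_real x ^ Suc k * nderiv 1 f x + of_nat (Suc k) * (of_real x ^ k * f x))) (at x)"
    by (simp add: algebra_simps)
  then show ?thesis
    by (simp add: nderiv_Suc vector_derivative_at)
qed

definition moment :: "nat \<Rightarrow> (real \<Rightarrow> complex) \<Rightarrow> complex" where
  "moment i f = (\<integral>x. of_real x ^ i * f x \<partial>lborel)"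

lemma moment_nderiv_Suc:
  assumes "f \<in> test_functions"
  shows "moment (Suc i) (nderiv 1 f) = - of_nat (Suc i) * moment i f"
proof -
  let ?g = "\<lambda>x. of_real x ^ Suc i * f x"
  note [simp] = test_function_integrable[OF test_function_power_mult[OF assms]]
     test_function_integrable[OF test_function_power_mult[OF test_function_nderiv[OF assms]]]
  have "0 = (\<integral>x. nderiv 1 ?g x \<partial>lborel)"
    by (rule integral_derivative_test_function[symmetric, OF test_function_power_mult[OF assms]])
  also have "\<dots> = moment (Suc i) (nderiv 1 f) + of_nat (Suc i) * moment i f"
    unfolding nderiv_1_power_Suc_mult[OF test_function_smooth[OF assms]] moment_def
    by (subst Bochner_Integration.integral_add) (simp_all del: power_Suc of_nat_Suc)
  finally show ?thesis by (simp add: algebra_simps eq_neg_iff_add_eq_0)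
qed

text \<open>Integration by parts \<open>r\<close> times: an \<open>r\<close>-th derivative annihilates all polynomials of degree less
than \<open>r\<close>. This is what makes all but one monomial disappear in the computation of the moments.\<close>

lemma moment_nderiv:
  assumes "f \<in> test_functions"
  shows "i < r \<Longrightarrow> moment i (nderiv r f) = 0"
    and "moment r (nderiv r f) = (-1) ^ r * fact r * moment 0 f"
proof -
  have *: "(i < r \<longrightarrow> moment i (nderiv r f) = 0) \<and> moment r (nderiv r f) = (-1) ^ r * fact r * moment 0 f" for i
  proof (induction r arbitrary: i)
    case (Suc r)
    have eq: "nderiv (Suc r) f = nderiv 1 (nderiv r f)" by (simp add: nderiv_nderiv)
    note t = test_function_nderiv[OF assms, of r]
    have "moment i (nderiv (Suc r) f) = 0" if "i < Suc r"
    proof (cases i)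
      case 0
      then show ?thesis unfolding eq using integral_derivative_test_function[OF t] by (simp add: moment_def)
    next
      case (Suc i')
      then show ?thesis using Suc.IH[of i'] that unfolding eq Suc moment_nderiv_Suc[OF t] by simp
    qed
    moreover have "moment (Suc r) (nderiv (Suc r) f) = (-1) ^ Suc r * fact (Suc r) * moment 0 f"
      unfolding eq moment_nderiv_Suc[OF t] using Suc.IH by (simp add: algebra_simps)
    ultimately show ?case by blast
  qed simp
  then show "i < r \<Longrightarrow> moment i (nderiv r f) = 0" 
    "moment r (nderiv r f) = (-1) ^ r * fact r * moment 0 f" by blast+
qed

lemma onorm_scaleR_vector_le:
  fixes v :: "'a::real_normed_vector"
  assumes "norm v \<le> C"
  shows "onorm (\<lambda>h. h *\<^sub>R v) \<le> C"
proof (rule onorm_le)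
  fix h :: real
  show "norm (h *\<^sub>R v) \<le> C * norm h"
    using mult_left_mono[OF assms, of "\<bar>h\<bar>"] by (simp add: mult.commute)
qed

text \<open>Complex-valued functions have no mean value form of the remainder, so the estimate is obtained by
induction on the order: the remainder of \<open>f\<close> has the remainder of \<open>f'\<close> as its derivative, and the
mean value inequality on the ball of radius \<open>\<bar>x\<bar>\<close> gains one power of \<open>\<bar>x\<bar>\<close>.\<close>

lemma taylor_bound:
  assumes "smooth f" "\<And>x. norm (nderiv (Suc n) f x) \<le> C"
  shows "norm (f x - (\<Sum>j\<le>n. nderiv j f 0 * of_real (x ^ j / fact j))) \<le> C * \<bar>x\<bar> ^ Suc n"
  using assms
proof (induction n arbitrary: f x)
  case 0
  have "norm (f x - f 0) \<le> C * norm (x - 0)"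
  proof (rule differentiable_bound[of UNIV f "\<lambda>y h. h *\<^sub>R nderiv 1 f y"])
    show "(f has_derivative (\<lambda>h. h *\<^sub>R nderiv 1 f y)) (at y within UNIV)" for y
      using smooth_has_vector_derivative[OF 0(1), of 0 y] by (simp add: has_vector_derivative_def)
    show "onorm (\<lambda>h. h *\<^sub>R nderiv 1 f y) \<le> C" for y
      using 0(2)[of y] by (simp add: onorm_scaleR_vector_le)
  qed auto
  then show ?case by simp
next
  case (Suc n)
  let ?P = "\<lambda>x. (\<Sum>j\<le>Suc n. nderiv j f 0 * of_real (x ^ j / fact j))"
  let ?Q = "\<lambda>x. (\<Sum>j\<le>n. nderiv j (nderiv 1 f) 0 * of_real (x ^ j / fact j))"
  have C: "0 \<le> C" using Suc.prems(2)[of 0] norm_ge_zero order_trans by blast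
  have IH: "norm (nderiv 1 f y - ?Q y) \<le> C * \<bar>y\<bar> ^ Suc n" for y
    using Suc.IH[OF smooth_nderiv[OF Suc.prems(1), of 1], of y] Suc.prems(2)
    by (simp add: nderiv_nderiv)
  have dP: "(?P has_vector_derivative ?Q y) (at y)" for y
  proof -
    have "((\<lambda>x. nderiv (Suc j) f 0 * of_real (x ^ Suc j / fact (Suc j))) has_vector_derivative
        nderiv (Suc j) f 0 * of_real (y ^ j / fact j)) (at y)" for j
    proof (intro has_vector_derivative_mult_right has_vector_derivative_of_real)
      have "((\<lambda>x. x ^ Suc j) has_field_derivative (real (Suc j) * y ^ j)) (at y)"
        using DERIV_pow[of "Suc j" y] by simp
      from DERIV_cdivide[OF this, of "fact (Suc j)"]
      moreover have "real (Suc j) * y ^ j / fact (Suc j) = y ^ j / fact j"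
        by (simp del: of_nat_Suc)
      ultimately show "((\<lambda>x. x ^ Suc j / fact (Suc j)) has_field_derivative (y ^ j / fact j)) (at y)"
        by (simp only:)
    qed
    then have "((\<lambda>x. f 0 +
        (\<Sum>j\<le>n. nderiv (Suc j) f 0 * of_real (x ^ Suc j / fact (Suc j)))) has_vector_derivative
        (0 + (\<Sum>j\<le>n. nderiv (Suc j) f 0 * of_real (y ^ j / fact j)))) (at y)"
      by (intro has_vector_derivative_add has_vector_derivative_sum has_vector_derivative_const)
    then show ?thesis
      unfolding sum.atMost_Suc_shift by (simp add: nderiv_nderiv)
  qed
  have "norm ((f x - ?P x) - (f 0 - ?P 0)) \<le> (C * \<bar>x\<bar> ^ Suc n) * norm (x - 0)"
  proof (rule differentiable_bound[of "cball 0 \<bar>x\<bar>" "\<lambda>x. f x - ?P x" "\<lambda>y h. h *\<^sub>R (nderiv 1 f y - ?Q y)"])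
    fix y :: real assume y: "y \<in> cball 0 \<bar>x\<bar>"
    have "((\<lambda>x. f x - ?P x) has_vector_derivative nderiv 1 f y - ?Q y) (at y)"
      using smooth_has_vector_derivative[OF Suc.prems(1), of 0 y]
      by (intro has_vector_derivative_diff dP) simp
    then show "((\<lambda>x. f x - ?P x) has_derivative (\<lambda>h. h *\<^sub>R (nderiv 1 f y - ?Q y))) (at y within cball 0 \<bar>x\<bar>)"
      unfolding has_vector_derivative_def by (rule has_derivative_at_withinI)
    have "C * \<bar>y\<bar> ^ Suc n \<le> C * \<bar>x\<bar> ^ Suc n"
      using y C by (intro mult_left_mono power_mono) auto
    with IH[of y] have "norm (nderiv 1 f y - ?Q y) \<le> C * \<bar>x\<bar> ^ Suc n" by linarith
    then show "onorm (\<lambda>h. h *\<^sub>R (nderiv 1 f y - ?Q y)) \<le> C * \<bar>x\<bar> ^ Suc n"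
      by (rule onorm_scaleR_vector_le)
  qed auto
  moreover have "?P 0 = f 0" unfolding sum.atMost_Suc_shift by simp
  ultimately show ?case by (simp add: mult_ac)
qed

section \<open>Moderate and null functions\<close>

lemma A_space_mono: "q \<le> r \<Longrightarrow> A_space r \<subseteq> A_space q"
  unfolding A_space_def by auto

lemma A_space_test_function: "\<phi> \<in> A_space q \<Longrightarrow> \<phi> \<in> test_functions"
  by (simp add: A_space_def)

lemma rescale_alt: "rescale \<epsilon> \<phi> = (\<lambda>x. of_real (1 / \<epsilon>) * \<phi> (1 / \<epsilon> * x + 0))"
  by (simp add: rescale_def)

lemma nderiv_rescale:
  assumes "smooth \<phi>"
  shows "nderiv m (rescale \<epsilon> \<phi>) = (\<lambda>x. of_real ((1 / \<epsilon>) ^ Suc m) * nderiv m \<phi> (x / \<epsilon>))"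
  unfolding rescale_alt nderiv_cmult[OF smooth_affine[OF assms]] nderiv_affine[OF assms]
  by (simp add: mult_ac)

lemma rescale_test_function:
  assumes "\<phi> \<in> test_functions" "\<epsilon> > 0"
  shows "rescale \<epsilon> \<phi> \<in> test_functions"
proof -
  from assms(1) obtain R where \<phi>: "smooth \<phi>" and "R > 0" and R: "\<And>x. R < \<bar>x\<bar> \<Longrightarrow> \<phi> x = 0"
    by (auto simp: test_function_iff)
  have "rescale \<epsilon> \<phi> x = 0" if "\<epsilon> * R < \<bar>x\<bar>" for x
    using that R[of "x / \<epsilon>"] \<open>\<epsilon> > 0\<close> by (simp add: rescale_def pos_less_divide_eq mult.commute)
  moreover have "smooth (rescale \<epsilon> \<phi>)"
    unfolding rescale_alt by (intro smooth_cmult smooth_affine \<phi>)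
  moreover have "\<epsilon> * R > 0" using \<open>R > 0\<close> \<open>\<epsilon> > 0\<close> by simp
  ultimately show ?thesis unfolding test_function_iff by blast
qed

lemma rescale_A_space:
  assumes "\<phi> \<in> A_space q" "\<epsilon> > 0"
  shows "rescale \<epsilon> \<phi> \<in> A_space 0"
proof -
  have "1 = (\<integral>x. \<phi> x \<partial>lborel)"
    using assms(1) by (auto simp: A_space_def dest: spec[of _ 0])
  also have "\<dots> = (\<integral>x. rescale \<epsilon> \<phi> x \<partial>lborel)"
    using \<open>\<epsilon> > 0\<close> by (subst lborel_integral_real_affine[of "1 / \<epsilon>" _ 0])
      (simp_all add: rescale_def scaleR_conv_of_real divide_inverse mult.commute)
  finally show ?thesis
    using rescale_test_function[OF A_space_test_function[OF assms(1)] assms(2)]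
    by (simp add: A_space_def)
qed

text \<open>The bounds that define moderate and null functions, with the supremum over \<open>K\<close> replaced by a
pointwise inequality. This form is stable under the Leibniz rule without any attention to whether
suprema are attained or finite.\<close>

definition growth :: "representative \<Rightarrow> real set \<Rightarrow> nat \<Rightarrow> (real \<Rightarrow> complex) \<Rightarrow> (real \<Rightarrow> real) \<Rightarrow> bool" where
  "growth f K m \<phi> w \<longleftrightarrow> (\<exists>C\<ge>0. \<forall>\<^sub>F \<epsilon> in at_right 0. \<forall>x\<in>K. norm (nderiv m (f (rescale \<epsilon> \<phi>)) x) \<le> C * w \<epsilon>)"

lemma eventually_at_right_0_pos: "\<forall>\<^sub>F \<epsilon> in at_right (0::real). 0 < \<epsilon> \<and> \<epsilon> \<le> 1"
  unfolding eventually_at_right_field by (rule exI[of _ 1]) auto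

text \<open>For each small \<open>\<epsilon>\<close> the derivative is continuous, hence bounded on the compact set \<open>K\<close>, so that the
supremum is a genuine least upper bound.\<close>

lemma bigo_SUP_iff_growth:
  assumes f: "f \<in> E_space" and \<phi>: "\<phi> \<in> A_space q" and K: "compact K" "K \<noteq> {}"
    and w: "\<And>\<epsilon>. \<epsilon> > 0 \<Longrightarrow> w \<epsilon> > 0"
  shows "(\<lambda>\<epsilon>. SUP x\<in>K. norm (nderiv m (f (rescale \<epsilon> \<phi>)) x)) \<in> O[at_right 0](w) \<longleftrightarrow> growth f K m \<phi> w"
proof -
  define N where "N \<epsilon> x = norm (nderiv m (f (rescale \<epsilon> \<phi>)) x)" for \<epsilon> x
  have N0: "0 \<le> N \<epsilon> x" for \<epsilon> x by (simp add: N_def)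
  have bdd: "bdd_above (N \<epsilon> ` K)" if "\<epsilon> > 0" for \<epsilon>
  proof -
    have "smooth (f (rescale \<epsilon> \<phi>))"
      using f rescale_A_space[OF \<phi> that] by (simp add: E_space_def)
    then have "compact (N \<epsilon> ` K)" unfolding N_def
      by (intro compact_continuous_image K continuous_on_norm smooth_continuous)
    then show ?thesis by (simp add: compact_imp_bounded bounded_imp_bdd_above)
  qed
  have SUP_le: "\<bar>SUP x\<in>K. N \<epsilon> x\<bar> \<le> c \<longleftrightarrow> (\<forall>x\<in>K. N \<epsilon> x \<le> c)" if "\<epsilon> > 0" for \<epsilon> c
  proof -
    obtain x where "x \<in> K" using K by blast
    then have "0 \<le> (SUP x\<in>K. N \<epsilon> x)"
      using cSUP_upper2[OF bdd[OF that], of x 0] N0 by simp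
    moreover have "(SUP x\<in>K. N \<epsilon> x) \<le> c \<longleftrightarrow> (\<forall>x\<in>K. N \<epsilon> x \<le> c)"
      by (rule cSUP_le_iff[OF K(2) bdd[OF that]])
    ultimately show ?thesis by simp
  qed
  have eq: "(\<forall>\<^sub>F \<epsilon> in at_right 0. norm (SUP x\<in>K. N \<epsilon> x) \<le> C * norm (w \<epsilon>)) \<longleftrightarrow>
      (\<forall>\<^sub>F \<epsilon> in at_right 0. \<forall>x\<in>K. N \<epsilon> x \<le> C * w \<epsilon>)" for C
    by (rule eventually_cong[OF eventually_at_right_0_pos]) (simp add: SUP_le w less_imp_le)
  show ?thesis
  proof
    assume "(\<lambda>\<epsilon>. SUP x\<in>K. norm (nderiv m (f (rescale \<epsilon> \<phi>)) x)) \<in> O[at_right 0](w)"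
    then show "growth f K m \<phi> w"
      unfolding growth_def N_def[symmetric] bigo_def eq[symmetric] by (auto intro: less_imp_le)
  next
    assume "growth f K m \<phi> w"
    then obtain C where "C \<ge> 0" "\<forall>\<^sub>F \<epsilon> in at_right 0. norm (SUP x\<in>K. N \<epsilon> x) \<le> C * norm (w \<epsilon>)"
      unfolding growth_def N_def[symmetric] eq[symmetric] by blast
    then show "(\<lambda>\<epsilon>. SUP x\<in>K. norm (nderiv m (f (rescale \<epsilon> \<phi>)) x)) \<in> O[at_right 0](w)"
      unfolding N_def by (intro bigoI)
  qed
qed

lemma growth_empty: "growth f {} m \<phi> w"
  by (auto simp: growth_def)

lemma growth_mono:
  assumes "growth f K m \<phi> w" "\<And>\<epsilon>. 0 < \<epsilon> \<Longrightarrow> \<epsilon> \<le> 1 \<Longrightarrow> w \<epsilon> \<le> w' \<epsilon>"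
  shows "growth f K m \<phi> w'"
proof -
  obtain C where "C \<ge> 0" and C: "\<forall>\<^sub>F \<epsilon> in at_right 0. \<forall>x\<in>K. norm (nderiv m (f (rescale \<epsilon> \<phi>)) x) \<le> C * w \<epsilon>"
    using assms(1) unfolding growth_def by blast
  have "\<forall>\<^sub>F \<epsilon> in at_right 0. \<forall>x\<in>K. norm (nderiv m (f (rescale \<epsilon> \<phi>)) x) \<le> C * w' \<epsilon>"
    using C eventually_at_right_0_pos
  proof eventually_elim
    case (elim \<epsilon>)
    then have "C * w \<epsilon> \<le> C * w' \<epsilon>" using assms(2) \<open>C \<ge> 0\<close> by (intro mult_left_mono) auto
    with elim(1) show ?case by (meson order_trans)
  qed
  with \<open>C \<ge> 0\<close> show ?thesis unfolding growth_def by blast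
qed

lemma E_space_smooth:
  assumes "f \<in> E_space" "\<phi> \<in> A_space q" "\<epsilon> > 0"
  shows "smooth (f (rescale \<epsilon> \<phi>))"
  using assms rescale_A_space unfolding E_space_def by blast

lemma growth_add:
  assumes "f \<in> E_space" "g \<in> E_space" "\<phi> \<in> A_space q" "growth f K m \<phi> w" "growth g K m \<phi> w"
  shows "growth (\<lambda>\<phi> x. f \<phi> x + g \<phi> x) K m \<phi> w"
proof -
  obtain C D where "C \<ge> 0" "D \<ge> 0"
    and C: "\<forall>\<^sub>F \<epsilon> in at_right 0. \<forall>x\<in>K. norm (nderiv m (f (rescale \<epsilon> \<phi>)) x) \<le> C * w \<epsilon>"
    and D: "\<forall>\<^sub>F \<epsilon> in at_right 0. \<forall>x\<in>K. norm (nderiv m (g (rescale \<epsilon> \<phi>)) x) \<le> D * w \<epsilon>"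
    using assms(4,5) unfolding growth_def by blast
  have "\<forall>\<^sub>F \<epsilon> in at_right 0. \<forall>x\<in>K. norm (nderiv m (\<lambda>x. f (rescale \<epsilon> \<phi>) x + g (rescale \<epsilon> \<phi>) x) x) \<le> (C + D) * w \<epsilon>"
    using C D eventually_at_right_0_pos
  proof eventually_elim
    case (elim \<epsilon>)
    show ?case
    proof
      fix x assume "x \<in> K"
      have "nderiv m (\<lambda>x. f (rescale \<epsilon> \<phi>) x + g (rescale \<epsilon> \<phi>) x) x =
          nderiv m (f (rescale \<epsilon> \<phi>)) x + nderiv m (g (rescale \<epsilon> \<phi>)) x"
        using elim(3) assms by (subst nderiv_add) (auto intro: E_space_smooth)
      also have "norm \<dots> \<le> C * w \<epsilon> + D * w \<epsilon>"
        using elim \<open>x \<in> K\<close> by (intro norm_triangle_le add_mono) auto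
      finally show "norm (nderiv m (\<lambda>x. f (rescale \<epsilon> \<phi>) x + g (rescale \<epsilon> \<phi>) x) x) \<le> (C + D) * w \<epsilon>"
        by (simp add: distrib_right)
    qed
  qed
  then show ?thesis unfolding growth_def using \<open>C \<ge> 0\<close> \<open>D \<ge> 0\<close> add_nonneg_nonneg by blast
qed

lemma growth_mult:
  assumes fg: "f \<in> E_space" "g \<in> E_space" and \<phi>: "\<phi> \<in> A_space q"
    and f: "\<And>i. i \<le> m \<Longrightarrow> growth f K i \<phi> w" and g: "\<And>i. i \<le> m \<Longrightarrow> growth g K i \<phi> w'"
  shows "growth (\<lambda>\<phi> x. f \<phi> x * g \<phi> x) K m \<phi> (\<lambda>\<epsilon>. w \<epsilon> * w' \<epsilon>)"
proof -
  have "\<forall>i\<in>{..m}. \<exists>C. C \<ge> 0 \<and> (\<forall>\<^sub>F \<epsilon> in at_right 0. \<forall>x\<in>K. norm (nderiv i (f (rescale \<epsilon> \<phi>)) x) \<le> C * w \<epsilon>)"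
    using f unfolding growth_def by simp
  from bchoice[OF this] obtain C where C0: "\<And>i. i \<le> m \<Longrightarrow> C i \<ge> 0"
    and C: "\<And>i. i \<le> m \<Longrightarrow> \<forall>\<^sub>F \<epsilon> in at_right 0. \<forall>x\<in>K. norm (nderiv i (f (rescale \<epsilon> \<phi>)) x) \<le> C i * w \<epsilon>"
    by auto
  have "\<forall>i\<in>{..m}. \<exists>C. C \<ge> 0 \<and> (\<forall>\<^sub>F \<epsilon> in at_right 0. \<forall>x\<in>K. norm (nderiv i (g (rescale \<epsilon> \<phi>)) x) \<le> C * w' \<epsilon>)"
    using g unfolding growth_def by simp
  from bchoice[OF this] obtain D where D0: "\<And>i. i \<le> m \<Longrightarrow> D i \<ge> 0"
    and D: "\<And>i. i \<le> m \<Longrightarrow> \<forall>\<^sub>F \<epsilon> in at_right 0. \<forall>x\<in>K. norm (nderiv i (g (rescale \<epsilon> \<phi>)) x) \<le> D i * w' \<epsilon>"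
    by auto
  define B where "B = (\<Sum>i\<le>m. of_nat (m choose i) * (C i * D (m - i)))"
  have "\<forall>\<^sub>F \<epsilon> in at_right 0. \<forall>i\<in>{..m}. \<forall>x\<in>K. norm (nderiv i (f (rescale \<epsilon> \<phi>)) x) \<le> C i * w \<epsilon>"
    using C by (intro eventually_ball_finite) auto
  moreover have "\<forall>\<^sub>F \<epsilon> in at_right 0. \<forall>i\<in>{..m}. \<forall>x\<in>K. norm (nderiv i (g (rescale \<epsilon> \<phi>)) x) \<le> D i * w' \<epsilon>"
    using D by (intro eventually_ball_finite) auto
  ultimately have "\<forall>\<^sub>F \<epsilon> in at_right 0. \<forall>x\<in>K.
      norm (nderiv m (\<lambda>x. f (rescale \<epsilon> \<phi>) x * g (rescale \<epsilon> \<phi>) x) x) \<le> B * (w \<epsilon> * w' \<epsilon>)"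
    using eventually_at_right_0_pos
  proof eventually_elim
    case (elim \<epsilon>)
    show ?case
    proof
      fix x assume x: "x \<in> K"
      let ?F = "\<lambda>i. nderiv i (f (rescale \<epsilon> \<phi>)) x" and ?G = "\<lambda>i. nderiv i (g (rescale \<epsilon> \<phi>)) x"
      have "norm (nderiv m (\<lambda>x. f (rescale \<epsilon> \<phi>) x * g (rescale \<epsilon> \<phi>) x) x) =
          norm (\<Sum>i\<le>m. of_nat (m choose i) * (?F i * ?G (m - i)))"
        using elim(3) fg \<phi> by (subst nderiv_mult) (auto intro: E_space_smooth)
      also have "\<dots> \<le> (\<Sum>i\<le>m. of_nat (m choose i) * ((C i * w \<epsilon>) * (D (m - i) * w' \<epsilon>)))"
      proof (intro sum_norm_le)
        fix i assume "i \<in> {..m}"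
        then have F: "norm (?F i) \<le> C i * w \<epsilon>" and G: "norm (?G (m - i)) \<le> D (m - i) * w' \<epsilon>"
          using elim x by auto
        have "norm (?F i * ?G (m - i)) \<le> (C i * w \<epsilon>) * (D (m - i) * w' \<epsilon>)"
          unfolding norm_mult using F G norm_ge_zero order_trans by (intro mult_mono) blast+
        then show "norm (of_nat (m choose i) * (?F i * ?G (m - i))) \<le>
            of_nat (m choose i) * ((C i * w \<epsilon>) * (D (m - i) * w' \<epsilon>))"
          by (simp add: norm_mult mult_left_mono)
      qed
      also have "\<dots> = B * (w \<epsilon> * w' \<epsilon>)"
        unfolding B_def sum_distrib_right by (simp add: mult_ac)
      finally show "norm (nderiv m (\<lambda>x. f (rescale \<epsilon> \<phi>) x * g (rescale \<epsilon> \<phi>) x) x) \<le> B * (w \<epsilon> * w' \<epsilon>)" .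
    qed
  qed
  moreover have "B \<ge> 0" unfolding B_def using C0 D0 by (intro sum_nonneg mult_nonneg_nonneg) auto
  ultimately show ?thesis unfolding growth_def by blast
qed

lemma E_moderate_iff:
  "f \<in> E_moderate \<longleftrightarrow> f \<in> E_space \<and>
     (\<forall>K m. compact K \<longrightarrow> (\<exists>q\<ge>1. \<forall>\<phi>\<in>A_space q. growth f K m \<phi> (\<lambda>\<epsilon>. 1 / \<epsilon> ^ q)))"
  (is "_ \<longleftrightarrow> _ \<and> ?R")
proof -
  have "(\<forall>K m. compact K \<and> K \<noteq> {} \<longrightarrow> (\<exists>q\<ge>1. \<forall>\<phi>\<in>A_space q.
        (\<lambda>\<epsilon>. SUP x\<in>K. norm (nderiv m (f (rescale \<epsilon> \<phi>)) x))
          \<in> O[at_right 0](\<lambda>\<epsilon>. 1 / \<epsilon> ^ q))) \<longleftrightarrow> ?R" (is "?L \<longleftrightarrow> _") if f: "f \<in> E_space"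
  proof -
    have "?L \<longleftrightarrow> (\<forall>K m. compact K \<and> K \<noteq> {} \<longrightarrow>
        (\<exists>q\<ge>1. \<forall>\<phi>\<in>A_space q. growth f K m \<phi> (\<lambda>\<epsilon>. 1 / \<epsilon> ^ q)))"
      (is "_ \<longleftrightarrow> (\<forall>K m. _ K \<longrightarrow> ?Q K m)")
      by (simp add: bigo_SUP_iff_growth[OF f] cong: conj_cong)
    also have "\<dots> \<longleftrightarrow> ?R"
    proof (intro iff_allI iffI impI)
      fix K :: "real set" and m
      assume *: "compact K \<and> K \<noteq> {} \<longrightarrow> ?Q K m" and "compact K"
      show "?Q K m"
      proof (cases "K = {}")
        case True
        then show ?thesis using growth_empty by (intro exI[of _ 1]) simp
      qed (use * \<open>compact K\<close> in blast)
    qed blast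
    finally show ?thesis .
  qed
  then show ?thesis unfolding E_moderate_def by blast
qed

lemma E_null_iff:
  "f \<in> E_null \<longleftrightarrow> f \<in> E_moderate \<and>
     (\<forall>K m. compact K \<longrightarrow> (\<exists>q\<ge>1. \<forall>r\<ge>q. \<forall>\<phi>\<in>A_space r. growth f K m \<phi> (\<lambda>\<epsilon>. \<epsilon> ^ (r - q))))"
  (is "_ \<longleftrightarrow> _ \<and> ?R")
proof -
  have "(\<forall>K m. compact K \<and> K \<noteq> {} \<longrightarrow> (\<exists>q\<ge>1. \<forall>r\<ge>q. \<forall>\<phi>\<in>A_space r.
        (\<lambda>\<epsilon>. SUP x\<in>K. norm (nderiv m (f (rescale \<epsilon> \<phi>)) x))
          \<in> O[at_right 0](\<lambda>\<epsilon>. \<epsilon> ^ (r - q)))) \<longleftrightarrow> ?R" (is "?L \<longleftrightarrow> _") if "f \<in> E_moderate"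
  proof -
    have f: "f \<in> E_space" using that by (simp add: E_moderate_def)
    have "?L \<longleftrightarrow> (\<forall>K m. compact K \<and> K \<noteq> {} \<longrightarrow>
        (\<exists>q\<ge>1. \<forall>r\<ge>q. \<forall>\<phi>\<in>A_space r. growth f K m \<phi> (\<lambda>\<epsilon>. \<epsilon> ^ (r - q))))"
      (is "_ \<longleftrightarrow> (\<forall>K m. _ K \<longrightarrow> ?Q K m)")
      by (simp add: bigo_SUP_iff_growth[OF f] cong: conj_cong)
    also have "\<dots> \<longleftrightarrow> ?R"
    proof (intro iff_allI iffI impI)
      fix K :: "real set" and m
      assume *: "compact K \<and> K \<noteq> {} \<longrightarrow> ?Q K m" and "compact K"
      show "?Q K m"
      proof (cases "K = {}")
        case True
        then show ?thesis using growth_empty by (intro exI[of _ 1]) simp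
      qed (use * \<open>compact K\<close> in blast)
    qed blast
    finally show ?thesis .
  qed
  then show ?thesis unfolding E_null_def by blast
qed

lemma inverse_power_mono: "(0::real) < \<epsilon> \<Longrightarrow> \<epsilon> \<le> 1 \<Longrightarrow> q \<le> r \<Longrightarrow> 1 / \<epsilon> ^ q \<le> 1 / \<epsilon> ^ r"
  by (intro divide_left_mono power_decreasing) auto

text \<open>The Leibniz rule involves all derivatives up to order \<open>m\<close>, each of which comes with its own \<open>q\<close>.
Enlarging \<open>q\<close> weakens both the bound and the set \<open>A_space q\<close> of admissible mollifiers, so one \<open>q\<close>
serves all of them.\<close>

lemma E_moderate_uniform:
  assumes "f \<in> E_moderate" "compact K"
  shows "\<exists>q\<ge>1. \<forall>i\<le>m. \<forall>\<phi>\<in>A_space q. growth f K i \<phi> (\<lambda>\<epsilon>. 1 / \<epsilon> ^ q)"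
proof -
  have "\<forall>i. \<exists>q. q \<ge> 1 \<and> (\<forall>\<phi>\<in>A_space q. growth f K i \<phi> (\<lambda>\<epsilon>. 1 / \<epsilon> ^ q))"
    using assms unfolding E_moderate_iff by blast
  from choice[OF this] obtain q where q1: "\<And>i. q i \<ge> 1"
      and q: "\<And>i \<phi>. \<phi> \<in> A_space (q i) \<Longrightarrow> growth f K i \<phi> (\<lambda>\<epsilon>. 1 / \<epsilon> ^ q i)"
    by blast
  define Q where "Q = (\<Sum>i\<le>m. q i)"
  have le: "q i \<le> Q" if "i \<le> m" for i
    unfolding Q_def using that by (intro member_le_sum) auto
  have "growth f K i \<phi> (\<lambda>\<epsilon>. 1 / \<epsilon> ^ Q)" if "i \<le> m" "\<phi> \<in> A_space Q" for i \<phi>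
  proof (rule growth_mono[OF q])
    show "\<phi> \<in> A_space (q i)" using A_space_mono[OF le[OF that(1)]] that by blast
  qed (rule inverse_power_mono[OF _ _ le[OF that(1)]])
  moreover have "Q \<ge> 1" using q1[of 0] le[of 0] by simp
  ultimately show ?thesis by blast
qed

lemma E_null_uniform:
  assumes "f \<in> E_null" "compact K"
  shows "\<exists>q\<ge>1. \<forall>i\<le>m. \<forall>r\<ge>q. \<forall>\<phi>\<in>A_space r. growth f K i \<phi> (\<lambda>\<epsilon>. \<epsilon> ^ (r - q))"
proof -
  have "\<forall>i. \<exists>q. q \<ge> 1 \<and> (\<forall>r\<ge>q. \<forall>\<phi>\<in>A_space r. growth f K i \<phi> (\<lambda>\<epsilon>. \<epsilon> ^ (r - q)))"
    using assms unfolding E_null_iff by blast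
  from choice[OF this] obtain q where q1: "\<And>i. q i \<ge> 1"
      and q: "\<And>i r \<phi>. q i \<le> r \<Longrightarrow> \<phi> \<in> A_space r \<Longrightarrow> growth f K i \<phi> (\<lambda>\<epsilon>. \<epsilon> ^ (r - q i))"
    by blast
  define Q where "Q = (\<Sum>i\<le>m. q i)"
  have le: "q i \<le> Q" if "i \<le> m" for i
    unfolding Q_def using that by (intro member_le_sum) auto
  have "growth f K i \<phi> (\<lambda>\<epsilon>. \<epsilon> ^ (r - Q))" if "i \<le> m" "Q \<le> r" "\<phi> \<in> A_space r" for i r \<phi>
  proof (rule growth_mono[OF q[of i r \<phi>]])
    show "\<epsilon> ^ (r - q i) \<le> \<epsilon> ^ (r - Q)" if "0 < \<epsilon>" "\<epsilon> \<le> 1" for \<epsilon> :: real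
      using that le[OF \<open>i \<le> m\<close>] by (intro power_decreasing) auto
  qed (use that le[of i] in auto)
  moreover have "Q \<ge> 1" using q1[of 0] le[of 0] by simp
  ultimately show ?thesis by blast
qed

lemma E_moderate_E_space: "f \<in> E_moderate \<Longrightarrow> f \<in> E_space"
  by (simp add: E_moderate_iff)

lemma E_null_E_moderate: "f \<in> E_null \<Longrightarrow> f \<in> E_moderate"
  by (simp add: E_null_iff)

lemma E_space_add: "f \<in> E_space \<Longrightarrow> g \<in> E_space \<Longrightarrow> (\<lambda>\<phi> x. f \<phi> x + g \<phi> x) \<in> E_space"
  by (simp add: E_space_def smooth_add)

lemma E_space_mult: "f \<in> E_space \<Longrightarrow> g \<in> E_space \<Longrightarrow> (\<lambda>\<phi> x. f \<phi> x * g \<phi> x) \<in> E_space"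
  by (simp add: E_space_def smooth_mult)

lemma E_moderate_add:
  assumes f: "f \<in> E_moderate" and g: "g \<in> E_moderate"
  shows "(\<lambda>\<phi> x. f \<phi> x + g \<phi> x) \<in> E_moderate"
  unfolding E_moderate_iff
proof (intro conjI allI impI)
  note E = E_moderate_E_space[OF f] E_moderate_E_space[OF g]
  show "(\<lambda>\<phi> x. f \<phi> x + g \<phi> x) \<in> E_space" by (intro E_space_add E)
  fix K :: "real set" and m assume K: "compact K"
  obtain q1 where q1: "q1 \<ge> 1" "\<And>\<phi>. \<phi> \<in> A_space q1 \<Longrightarrow> growth f K m \<phi> (\<lambda>\<epsilon>. 1 / \<epsilon> ^ q1)"
    using E_moderate_uniform[OF f K, of m] by blast
  obtain q2 where q2: "q2 \<ge> 1" "\<And>\<phi>. \<phi> \<in> A_space q2 \<Longrightarrow> growth g K m \<phi> (\<lambda>\<epsilon>. 1 / \<epsilon> ^ q2)"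
    using E_moderate_uniform[OF g K, of m] by blast
  have "growth (\<lambda>\<phi> x. f \<phi> x + g \<phi> x) K m \<phi> (\<lambda>\<epsilon>. 1 / \<epsilon> ^ (q1 + q2))" if "\<phi> \<in> A_space (q1 + q2)" for \<phi>
  proof (rule growth_add[OF E that])
    have "\<phi> \<in> A_space q1" "\<phi> \<in> A_space q2" using that A_space_mono[of q1 "q1 + q2"] A_space_mono[of q2 "q1 + q2"] by auto
    then show "growth f K m \<phi> (\<lambda>\<epsilon>. 1 / \<epsilon> ^ (q1 + q2))" "growth g K m \<phi> (\<lambda>\<epsilon>. 1 / \<epsilon> ^ (q1 + q2))"
      by (auto intro!: growth_mono[OF q1(2)] growth_mono[OF q2(2)] inverse_power_mono)
  qed
  then show "\<exists>q\<ge>1. \<forall>\<phi>\<in>A_space q. growth (\<lambda>\<phi> x. f \<phi> x + g \<phi> x) K m \<phi> (\<lambda>\<epsilon>. 1 / \<epsilon> ^ q)"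
    using \<open>q1 \<ge> 1\<close> by (intro exI[of _ "q1 + q2"]) auto
qed

lemma E_moderate_mult:
  assumes f: "f \<in> E_moderate" and g: "g \<in> E_moderate"
  shows "(\<lambda>\<phi> x. f \<phi> x * g \<phi> x) \<in> E_moderate"
  unfolding E_moderate_iff
proof (intro conjI allI impI)
  note E = E_moderate_E_space[OF f] E_moderate_E_space[OF g]
  show "(\<lambda>\<phi> x. f \<phi> x * g \<phi> x) \<in> E_space" by (intro E_space_mult E)
  fix K :: "real set" and m assume K: "compact K"
  obtain q1 where q1: "q1 \<ge> 1" "\<And>i \<phi>. i \<le> m \<Longrightarrow> \<phi> \<in> A_space q1 \<Longrightarrow> growth f K i \<phi> (\<lambda>\<epsilon>. 1 / \<epsilon> ^ q1)"
    using E_moderate_uniform[OF f K, of m] by blast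
  obtain q2 where q2: "q2 \<ge> 1" "\<And>i \<phi>. i \<le> m \<Longrightarrow> \<phi> \<in> A_space q2 \<Longrightarrow> growth g K i \<phi> (\<lambda>\<epsilon>. 1 / \<epsilon> ^ q2)"
    using E_moderate_uniform[OF g K, of m] by blast
  have "growth (\<lambda>\<phi> x. f \<phi> x * g \<phi> x) K m \<phi> (\<lambda>\<epsilon>. 1 / \<epsilon> ^ (q1 + q2))" if "\<phi> \<in> A_space (q1 + q2)" for \<phi>
  proof -
    have "\<phi> \<in> A_space q1" "\<phi> \<in> A_space q2" using that A_space_mono[of q1 "q1 + q2"] A_space_mono[of q2 "q1 + q2"] by auto
    then have "growth (\<lambda>\<phi> x. f \<phi> x * g \<phi> x) K m \<phi> (\<lambda>\<epsilon>. 1 / \<epsilon> ^ q1 * (1 / \<epsilon> ^ q2))"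
      by (intro growth_mult[OF E that] q1 q2)
    then show ?thesis by (simp add: power_add)
  qed
  then show "\<exists>q\<ge>1. \<forall>\<phi>\<in>A_space q. growth (\<lambda>\<phi> x. f \<phi> x * g \<phi> x) K m \<phi> (\<lambda>\<epsilon>. 1 / \<epsilon> ^ q)"
    using \<open>q1 \<ge> 1\<close> by (intro exI[of _ "q1 + q2"]) auto
qed

lemma E_null_add:
  assumes f: "f \<in> E_null" and g: "g \<in> E_null"
  shows "(\<lambda>\<phi> x. f \<phi> x + g \<phi> x) \<in> E_null"
  unfolding E_null_iff
proof (intro conjI allI impI)
  note M = E_null_E_moderate[OF f] E_null_E_moderate[OF g]
  note E = M[THEN E_moderate_E_space]
  show "(\<lambda>\<phi> x. f \<phi> x + g \<phi> x) \<in> E_moderate" by (intro E_moderate_add M)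
  fix K :: "real set" and m assume K: "compact K"
  obtain q1 where q1: "q1 \<ge> 1" "\<And>r \<phi>. q1 \<le> r \<Longrightarrow> \<phi> \<in> A_space r \<Longrightarrow> growth f K m \<phi> (\<lambda>\<epsilon>. \<epsilon> ^ (r - q1))"
    using E_null_uniform[OF f K, of m] by blast
  obtain q2 where q2: "q2 \<ge> 1" "\<And>r \<phi>. q2 \<le> r \<Longrightarrow> \<phi> \<in> A_space r \<Longrightarrow> growth g K m \<phi> (\<lambda>\<epsilon>. \<epsilon> ^ (r - q2))"
    using E_null_uniform[OF g K, of m] by blast
  have "growth (\<lambda>\<phi> x. f \<phi> x + g \<phi> x) K m \<phi> (\<lambda>\<epsilon>. \<epsilon> ^ (r - (q1 + q2)))"
    if "q1 + q2 \<le> r" "\<phi> \<in> A_space r" for r \<phi>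
    using that by (intro growth_add[OF E that(2)] growth_mono[OF q1(2)[of r]] growth_mono[OF q2(2)[of r]] power_decreasing) auto
  then show "\<exists>q\<ge>1. \<forall>r\<ge>q. \<forall>\<phi>\<in>A_space r. growth (\<lambda>\<phi> x. f \<phi> x + g \<phi> x) K m \<phi> (\<lambda>\<epsilon>. \<epsilon> ^ (r - q))"
    using \<open>q1 \<ge> 1\<close> by (intro exI[of _ "q1 + q2"]) auto
qed

text \<open>If \<open>g\<close> grows like \<open>\<epsilon> ^ -q2\<close> and \<open>f\<close> decays like \<open>\<epsilon> ^ (r - q1)\<close> for every large \<open>r\<close>, then the product
decays like \<open>\<epsilon> ^ (r - (q1 + q2))\<close>: the loss does not depend on \<open>r\<close>.\<close>

lemma E_null_mult:
  assumes f: "f \<in> E_null" and g: "g \<in> E_moderate"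
  shows "(\<lambda>\<phi> x. f \<phi> x * g \<phi> x) \<in> E_null"
  unfolding E_null_iff
proof (intro conjI allI impI)
  note M = E_null_E_moderate[OF f] g
  note E = M[THEN E_moderate_E_space]
  show "(\<lambda>\<phi> x. f \<phi> x * g \<phi> x) \<in> E_moderate" by (intro E_moderate_mult M)
  fix K :: "real set" and m assume K: "compact K"
  obtain q1 where q1: "q1 \<ge> 1" "\<And>i r \<phi>. i \<le> m \<Longrightarrow> q1 \<le> r \<Longrightarrow> \<phi> \<in> A_space r \<Longrightarrow> growth f K i \<phi> (\<lambda>\<epsilon>. \<epsilon> ^ (r - q1))"
    using E_null_uniform[OF f K, of m] by blast
  obtain q2 where q2: "q2 \<ge> 1" "\<And>i \<phi>. i \<le> m \<Longrightarrow> \<phi> \<in> A_space q2 \<Longrightarrow> growth g K i \<phi> (\<lambda>\<epsilon>. 1 / \<epsilon> ^ q2)"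
    using E_moderate_uniform[OF g K, of m] by blast
  have "growth (\<lambda>\<phi> x. f \<phi> x * g \<phi> x) K m \<phi> (\<lambda>\<epsilon>. \<epsilon> ^ (r - (q1 + q2)))"
    if r: "q1 + q2 \<le> r" and \<phi>: "\<phi> \<in> A_space r" for r \<phi>
  proof (rule growth_mono)
    have "\<phi> \<in> A_space q2" using \<phi> r A_space_mono[of q2 r] by auto
    then show "growth (\<lambda>\<phi> x. f \<phi> x * g \<phi> x) K m \<phi> (\<lambda>\<epsilon>. \<epsilon> ^ (r - q1) * (1 / \<epsilon> ^ q2))"
      using r by (intro growth_mult[OF E \<phi>] q1 q2 \<phi>) auto
    show "\<epsilon> ^ (r - q1) * (1 / \<epsilon> ^ q2) \<le> \<epsilon> ^ (r - (q1 + q2))" if "0 < \<epsilon>" for \<epsilon> :: real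
    proof -
      have "r - q1 = (r - (q1 + q2)) + q2" using r by simp
      then show ?thesis using that by (simp add: power_add)
    qed
  qed
  then show "\<exists>q\<ge>1. \<forall>r\<ge>q. \<forall>\<phi>\<in>A_space r. growth (\<lambda>\<phi> x. f \<phi> x * g \<phi> x) K m \<phi> (\<lambda>\<epsilon>. \<epsilon> ^ (r - q))"
    using \<open>q1 \<ge> 1\<close> by (intro exI[of _ "q1 + q2"]) auto
qed

lemma E_moderate_const: "(\<lambda>\<phi> x. c) \<in> E_moderate"
  unfolding E_moderate_iff
proof (intro conjI allI impI exI[of _ 1] ballI)
  show "(\<lambda>\<phi> x. c) \<in> E_space" by (simp add: E_space_def smooth_const)
  fix K :: "real set" and m \<phi>
  have "norm (nderiv m (\<lambda>x. c) x) \<le> norm c" for x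
    by (cases m) (simp_all add: nderiv_const)
  moreover have "norm c \<le> norm c * (1 / \<epsilon> ^ 1)" if "0 < \<epsilon>" "\<epsilon> \<le> 1" for \<epsilon> :: real
    using that mult_left_mono[of 1 "1 / \<epsilon>" "norm c"] by simp
  ultimately have "\<forall>\<^sub>F \<epsilon> in at_right 0. \<forall>x\<in>K. norm (nderiv m (\<lambda>x. c) x) \<le> norm c * (1 / \<epsilon> ^ 1)"
    by (intro eventually_mono[OF eventually_at_right_0_pos]) (blast intro: order_trans)
  then show "growth (\<lambda>\<phi> x. c) K m \<phi> (\<lambda>\<epsilon>. 1 / \<epsilon> ^ 1)"
    unfolding growth_def by (intro exI[of _ "norm c"]) auto
qed simp

lemma E_null_0: "(\<lambda>\<phi> x. 0) \<in> E_null"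
proof -
  have "nderiv m (\<lambda>x. 0) = (\<lambda>x. 0)" for m
    by (cases m) (simp_all add: nderiv_const)
  then have "growth (\<lambda>\<phi> x. 0) K m \<phi> w" for K m \<phi> w
    unfolding growth_def by (intro exI[of _ 0]) simp
  then show ?thesis unfolding E_null_iff using E_moderate_const[of 0] by auto
qed

lemma E_moderate_cmult: "f \<in> E_moderate \<Longrightarrow> (\<lambda>\<phi> x. c * f \<phi> x) \<in> E_moderate"
  by (rule E_moderate_mult[OF E_moderate_const])

lemma E_null_cmult: "f \<in> E_null \<Longrightarrow> (\<lambda>\<phi> x. c * f \<phi> x) \<in> E_null"
  using E_null_mult[OF _ E_moderate_const[of c], of f] by (simp add: mult.commute)

lemma moderate_ring_simps [simp]:
  "carrier moderate_ring = E_moderate"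
  "f \<otimes>\<^bsub>moderate_ring\<^esub> g = (\<lambda>\<phi> x. f \<phi> x * g \<phi> x)"
  "f \<oplus>\<^bsub>moderate_ring\<^esub> g = (\<lambda>\<phi> x. f \<phi> x + g \<phi> x)"
  "\<zero>\<^bsub>moderate_ring\<^esub> = (\<lambda>\<phi> x. 0)" "\<one>\<^bsub>moderate_ring\<^esub> = (\<lambda>\<phi> x. 1)"
  by (simp_all add: moderate_ring_def)

lemma moderate_ring_cring: "cring moderate_ring"
proof (rule cringI)
  show "abelian_group moderate_ring"
  proof (rule abelian_groupI)
    fix f assume "f \<in> carrier moderate_ring"
    then have "(\<lambda>\<phi> x. - 1 * f \<phi> x) \<in> E_moderate" by (simp only: E_moderate_cmult moderate_ring_simps)
    then show "\<exists>g\<in>carrier moderate_ring. g \<oplus>\<^bsub>moderate_ring\<^esub> f = \<zero>\<^bsub>moderate_ring\<^esub>"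
      by (intro bexI[of _ "\<lambda>\<phi> x. - 1 * f \<phi> x"]) auto
  qed (auto simp: E_moderate_add E_moderate_const add_ac)
  show "comm_monoid moderate_ring"
    by (rule comm_monoidI) (auto simp: E_moderate_mult E_moderate_const mult_ac)
qed (simp add: distrib_right)

lemma moderate_ring_uminus:
  assumes "f \<in> E_moderate"
  shows "\<ominus>\<^bsub>moderate_ring\<^esub> f = (\<lambda>\<phi> x. - f \<phi> x)"
proof -
  interpret cring moderate_ring by (rule moderate_ring_cring)
  have "(\<lambda>\<phi> x. - f \<phi> x) \<in> E_moderate"
    using E_moderate_cmult[OF assms, of "-1"] by simp
  then show ?thesis using assms by (intro minus_equality) auto
qed

lemma E_null_ideal: "ideal E_null moderate_ring"
proof (rule idealI)
  interpret cring moderate_ring by (rule moderate_ring_cring)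
  show "ring moderate_ring" ..
  show "subgroup E_null (add_monoid moderate_ring)"
  proof (rule add.subgroupI)
    fix f assume f: "f \<in> E_null"
    have "\<ominus>\<^bsub>moderate_ring\<^esub> f = (\<lambda>\<phi> x. - f \<phi> x)"
      by (rule moderate_ring_uminus[OF E_null_E_moderate[OF f]])
    then show "\<ominus>\<^bsub>moderate_ring\<^esub> f \<in> E_null"
      using E_null_cmult[OF f, of "-1"] by simp
  qed (use E_null_0 in \<open>auto simp: E_null_add E_null_E_moderate\<close>)
  fix f g assume "f \<in> E_null" "g \<in> carrier moderate_ring"
  then show "f \<otimes>\<^bsub>moderate_ring\<^esub> g \<in> E_null" "g \<otimes>\<^bsub>moderate_ring\<^esub> f \<in> E_null"
    using E_null_mult[of f g] by (auto simp: mult.commute)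
qed

lemma colombeau_hom: "ring_hom_cring moderate_ring colombeau ((+>\<^bsub>moderate_ring\<^esub>) E_null)"
  unfolding colombeau_def using E_null_ideal moderate_ring_cring by (rule ideal.rcos_ring_hom_cring)

text \<open>The quotient map is a ring homomorphism, so that the class on the left-hand side of the theorem is the
class of the same expression in the representatives. The integer multiple by \<open>(-1) ^ p\<close> is the identity
or the additive inverse.\<close>

lemma colombeau_combination:
  fixes p :: nat
  assumes m: "A \<in> E_moderate" "B \<in> E_moderate" "C \<in> E_moderate" "D \<in> E_moderate"
  defines "cls \<equiv> \<lambda>f. E_null +>\<^bsub>moderate_ring\<^esub> f"
  shows "([((-1 :: int) ^ p)] \<cdot>\<^bsub>colombeau\<^esub> (cls A \<otimes>\<^bsub>colombeau\<^esub> cls B))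
      \<oplus>\<^bsub>colombeau\<^esub> (cls C \<otimes>\<^bsub>colombeau\<^esub> cls D) = cls (\<lambda>\<phi> x. (-1) ^ p * (A \<phi> x * B \<phi> x) + C \<phi> x * D \<phi> x)"
proof -
  interpret ring_hom_cring moderate_ring colombeau cls
    unfolding cls_def by (rule colombeau_hom)
  have AB: "(\<lambda>\<phi> x. A \<phi> x * B \<phi> x) \<in> E_moderate" and CD: "(\<lambda>\<phi> x. C \<phi> x * D \<phi> x) \<in> E_moderate"
    using m by (simp_all add: E_moderate_mult)
  have sAB: "(\<lambda>\<phi> x. (-1) ^ p * (A \<phi> x * B \<phi> x)) \<in> E_moderate"
    using E_moderate_cmult[OF AB] by simp
  have prod: "cls A \<otimes>\<^bsub>colombeau\<^esub> cls B = cls (\<lambda>\<phi> x. A \<phi> x * B \<phi> x)"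
      "cls C \<otimes>\<^bsub>colombeau\<^esub> cls D = cls (\<lambda>\<phi> x. C \<phi> x * D \<phi> x)"
    using m hom_mult[of A B] hom_mult[of C D] by simp_all
  have car: "cls (\<lambda>\<phi> x. A \<phi> x * B \<phi> x) \<in> carrier colombeau"
    using AB by (intro hom_closed) simp
  have "[((-1 :: int) ^ p)] \<cdot>\<^bsub>colombeau\<^esub> cls (\<lambda>\<phi> x. A \<phi> x * B \<phi> x) = cls (\<lambda>\<phi> x. (-1) ^ p * (A \<phi> x * B \<phi> x))"
  proof (cases "even p")
    case True
    then show ?thesis using S.add.int_pow_1[OF car] by simp
  next
    case False
    have "[(-1::int)] \<cdot>\<^bsub>colombeau\<^esub> cls (\<lambda>\<phi> x. A \<phi> x * B \<phi> x) = \<ominus>\<^bsub>colombeau\<^esub> cls (\<lambda>\<phi> x. A \<phi> x * B \<phi> x)"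
      using S.add.int_pow_neg[OF car, of 1] S.add.int_pow_1[OF car] by simp
    also have "\<dots> = cls (\<lambda>\<phi> x. - (A \<phi> x * B \<phi> x))"
      using hom_a_inv[of "\<lambda>\<phi> x. A \<phi> x * B \<phi> x"] AB moderate_ring_uminus[OF AB] by simp
    finally show ?thesis using False by simp
  qed
  then show ?thesis
    unfolding prod using hom_add[of "\<lambda>\<phi> x. (-1) ^ p * (A \<phi> x * B \<phi> x)" "\<lambda>\<phi> x. C \<phi> x * D \<phi> x"] sAB CD
    by simp
qed

section \<open>Smoothing of locally integrable functions\<close>

definition loc_integrable :: "(real \<Rightarrow> real) \<Rightarrow> bool" where
  "loc_integrable h \<longleftrightarrow> h \<in> borel_measurable borel \<and> (\<forall>R. set_integrable lborel {-R..R} h)"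

lemma loc_integrable_mult:
  fixes g :: "real \<Rightarrow> complex"
  assumes h: "loc_integrable h" and g[measurable]: "g \<in> borel_measurable borel"
    and B: "\<And>y. norm (g y) \<le> B" and R: "\<And>y. R < \<bar>y\<bar> \<Longrightarrow> g y = 0"
  shows "integrable lborel (\<lambda>y. of_real (h y) * g y)"
    and "(\<integral>y. norm (of_real (h y) * g y) \<partial>lborel) \<le> B * (\<integral>y\<in>{-R..R}. \<bar>h y\<bar> \<partial>lborel)"
proof -
  have [measurable]: "h \<in> borel_measurable borel" using h by (simp add: loc_integrable_def)
  have int: "integrable lborel (\<lambda>y. B * (indicator {-R..R} y * \<bar>h y\<bar>))"
    using h set_integrable_abs[of lborel "{-R..R}" h]
    by (intro integrable_mult_right) (simp add: loc_integrable_def set_integrable_def)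
  have le: "norm (of_real (h y) * g y) \<le> B * (indicator {-R..R} y * \<bar>h y\<bar>)" for y
    using mult_right_mono[OF B[of y], of "\<bar>h y\<bar>"] R[of y]
    by (cases "R < \<bar>y\<bar>") (auto simp: norm_mult mult.commute indicator_def)
  have "B \<ge> 0" using B[of 0] norm_ge_zero order_trans by blast
  show 1: "integrable lborel (\<lambda>y. of_real (h y) * g y)"
    by (rule Bochner_Integration.integrable_bound[OF int])
      (use le \<open>B \<ge> 0\<close> in \<open>auto simp: abs_mult\<close>)
  show "(\<integral>y. norm (of_real (h y) * g y) \<partial>lborel) \<le> B * (\<integral>y\<in>{-R..R}. \<bar>h y\<bar> \<partial>lborel)"
  proof -
    have "(\<integral>y. norm (of_real (h y) * g y) \<partial>lborel) \<le> (\<integral>y. B * (indicator {-R..R} y * \<bar>h y\<bar>) \<partial>lborel)"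
      by (rule integral_mono[OF integrable_norm[OF 1] int le])
    then show ?thesis by (simp add: set_lebesgue_integral_def)
  qed
qed

text \<open>The convolution of \<open>h\<close> with the reflection of \<open>\<theta>\<close>. All four embedded distributions have
representatives of the form \<open>\<plusminus> corr h (nderiv r \<phi>)\<close> with a locally integrable \<open>h\<close>.\<close>

definition corr :: "(real \<Rightarrow> real) \<Rightarrow> (real \<Rightarrow> complex) \<Rightarrow> real \<Rightarrow> complex" where
  "corr h \<theta> x = (\<integral>u. of_real (h (x + u)) * \<theta> u \<partial>lborel)"

lemma corr_shift: "corr h \<theta> x = (\<integral>y. of_real (h y) * \<theta> (y - x) \<partial>lborel)"
  unfolding corr_def by (subst lborel_integral_real_affine[of 1 _ "-x"]) simp_all

lemma corr_integrable_bound: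
  assumes h: "loc_integrable h" and \<theta>[measurable]: "\<theta> \<in> borel_measurable borel"
    and B: "\<And>y. norm (\<theta> y) \<le> B" and R: "\<And>y. R < \<bar>y\<bar> \<Longrightarrow> \<theta> y = 0" and x: "\<bar>x\<bar> \<le> M"
  shows "integrable lborel (\<lambda>y. of_real (h y) * \<theta> (y - x))"
    and "integrable lborel (\<lambda>u. of_real (h (x + u)) * \<theta> u)"
    and "(\<integral>u. norm (of_real (h (x + u)) * \<theta> u) \<partial>lborel) \<le> B * (\<integral>y\<in>{-(R+M)..R+M}. \<bar>h y\<bar> \<partial>lborel)"
    and "norm (corr h \<theta> x) \<le> B * (\<integral>y\<in>{-(R+M)..R+M}. \<bar>h y\<bar> \<partial>lborel)"
proof -
  have g: "(\<lambda>y. \<theta> (y - x)) \<in> borel_measurable borel" by measurable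
  have B': "norm (\<theta> (y - x)) \<le> B" for y by (rule B)
  have R': "\<theta> (y - x) = 0" if "R + M < \<bar>y\<bar>" for y
    using that x by (intro R) linarith
  show int: "integrable lborel (\<lambda>y. of_real (h y) * \<theta> (y - x))"
    by (rule loc_integrable_mult(1)[OF h g B' R'])
  show "integrable lborel (\<lambda>u. of_real (h (x + u)) * \<theta> u)"
    using lborel_integrable_real_affine[OF int, of 1 x] by simp
  have "(\<integral>u. norm (of_real (h (x + u)) * \<theta> u) \<partial>lborel) = (\<integral>y. norm (of_real (h y) * \<theta> (y - x)) \<partial>lborel)"
    by (subst lborel_integral_real_affine[of 1 _ "-x"]) simp_all
  then show norm: "(\<integral>u. norm (of_real (h (x + u)) * \<theta> u) \<partial>lborel) \<le> B * (\<integral>y\<in>{-(R+M)..R+M}. \<bar>h y\<bar> \<partial>lborel)"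
    by (rule ord_eq_le_trans[OF _ loc_integrable_mult(2)[OF h g B' R']])
  show "norm (corr h \<theta> x) \<le> B * (\<integral>y\<in>{-(R+M)..R+M}. \<bar>h y\<bar> \<partial>lborel)"
    unfolding corr_def by (rule order_trans[OF integral_norm_bound norm])
qed

text \<open>Since \<open>h\<close> may be unbounded, the difference quotient is estimated directly: after the substitution that
moves the argument to \<open>\<theta>\<close>, the second order Taylor remainder of \<open>\<theta>\<close> is uniformly \<open>O((z - x)\<^sup>2)\<close> and
supported in a fixed interval, on which \<open>h\<close> is integrable.\<close>

lemma corr_derivative:
  assumes h: "loc_integrable h" and \<theta>: "\<theta> \<in> test_functions"
  shows "(corr h \<theta> has_vector_derivative - corr h (nderiv 1 \<theta>) x) (at x)"
proof -
  from \<theta> obtain R where sm: "smooth \<theta>" and R: "\<And>x. R < \<bar>x\<bar> \<Longrightarrow> \<theta> x = 0"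
    by (auto simp: test_function_iff)
  have R': "nderiv 1 \<theta> y = 0" if "R < \<bar>y\<bar>" for y
    using nderiv_outside[of R \<theta> y 1] R that by blast
  note \<theta>' = test_function_nderiv[OF \<theta>, of 1] and \<theta>'' = test_function_nderiv[OF \<theta>, of 2]
  obtain B0 where B0: "\<And>x. norm (\<theta> x) \<le> B0" using test_function_bounded[OF \<theta>] by blast
  obtain B1 where B1: "\<And>x. norm (nderiv 1 \<theta> x) \<le> B1" using test_function_bounded[OF \<theta>'] by blast
  obtain B where B: "\<And>x. norm (nderiv 2 \<theta> x) \<le> B" using test_function_bounded[OF \<theta>''] by blast
  note [measurable] = test_function_measurable[OF \<theta>] test_function_measurable[OF \<theta>']
  define I where "I = (\<integral>y\<in>{-(R+(\<bar>x\<bar>+1))..R+(\<bar>x\<bar>+1)}. \<bar>h y\<bar> \<partial>lborel)"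
  have quad: "norm (corr h \<theta> z - corr h \<theta> x - (z - x) *\<^sub>R (- corr h (nderiv 1 \<theta>) x)) \<le> B * I * \<bar>z - x\<bar> ^ 2"
    if z: "\<bar>z - x\<bar> < 1" for z
  proof -
    define g where "g y = \<theta> (y - z) - \<theta> (y - x) + of_real (z - x) * nderiv 1 \<theta> (y - x)" for y
    have [measurable]: "g \<in> borel_measurable borel" unfolding g_def by measurable
    have i: "integrable lborel (\<lambda>y. of_real (h y) * \<theta> (y - z))"
      "integrable lborel (\<lambda>y. of_real (h y) * \<theta> (y - x))"
      "integrable lborel (\<lambda>y. of_real (h y) * nderiv 1 \<theta> (y - x))"
      by (rule corr_integrable_bound(1)[OF h _ B0 R order_refl]
            corr_integrable_bound(1)[OF h _ B1 R' order_refl]; measurable)+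
    have "corr h \<theta> z - corr h \<theta> x - (z - x) *\<^sub>R (- corr h (nderiv 1 \<theta>) x) =
        corr h \<theta> z - corr h \<theta> x + of_real (z - x) * corr h (nderiv 1 \<theta>) x"
      by (simp add: scaleR_conv_of_real)
    also have "\<dots> = (\<integral>y. of_real (h y) * \<theta> (y - z) - of_real (h y) * \<theta> (y - x)
        + of_real (z - x) * (of_real (h y) * nderiv 1 \<theta> (y - x)) \<partial>lborel)"
      unfolding corr_shift by (simp add: i del: of_real_diff One_nat_def)
    also have "\<dots> = (\<integral>y. of_real (h y) * g y \<partial>lborel)"
      by (intro Bochner_Integration.integral_cong) (simp_all add: g_def algebra_simps)
    also have "norm \<dots> \<le> (B * \<bar>z - x\<bar> ^ 2) * I"
      unfolding I_def
    proof (rule order_trans[OF integral_norm_bound loc_integrable_mult(2)[OF h]])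
      fix y
      have "norm (\<theta> (- 1 * (z - x) + (y - x)) -
          (\<Sum>j\<le>1. nderiv j (\<lambda>t. \<theta> (- 1 * t + (y - x))) 0 * of_real ((z - x) ^ j / fact j))) \<le> B * \<bar>z - x\<bar> ^ Suc 1"
      proof (rule taylor_bound[OF smooth_affine[OF sm]])
        show "norm (nderiv (Suc 1) (\<lambda>t. \<theta> (- 1 * t + (y - x))) t) \<le> B" for t
          unfolding nderiv_affine[OF sm] using B[of "- 1 * t + (y - x)"] by (simp add: numeral_2_eq_2)
      qed
      then show "norm (g y) \<le> B * \<bar>z - x\<bar> ^ 2"
        unfolding nderiv_affine[OF sm] g_def by (simp add: numeral_2_eq_2 algebra_simps)
      show "g y = 0" if y: "R + (\<bar>x\<bar> + 1) < \<bar>y\<bar>"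
      proof -
        have "R < \<bar>y - x\<bar>" "R < \<bar>y - z\<bar>" using y z by linarith+
        then show ?thesis using R R' by (simp add: g_def)
      qed
    qed measurable
    finally show ?thesis by (simp add: mult_ac)
  qed
  show ?thesis
    unfolding has_vector_derivative_def
  proof (rule has_derivativeI_sandwich[of 1 _ _ _ _ "\<lambda>z. B * I * \<bar>z - x\<bar>"])
    show "((\<lambda>z. B * I * \<bar>z - x\<bar>) \<longlongrightarrow> 0) (at x)"
      by (rule tendsto_eq_intros refl | simp)+
    fix z assume "z \<noteq> x" "dist z x < 1"
    then show "norm (corr h \<theta> z - corr h \<theta> x - (z - x) *\<^sub>R (- corr h (nderiv 1 \<theta>) x)) / norm (z - x) \<le> B * I * \<bar>z - x\<bar>"
      using quad[of z] by (simp add: dist_real_def pos_divide_le_eq power2_eq_square mult.assoc)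
  qed (rule bounded_linear_scaleR_left zero_less_one)+
qed

lemma
  assumes h: "loc_integrable h" and \<theta>: "\<theta> \<in> test_functions"
  shows smooth_corr: "smooth (corr h \<theta>)"
    and nderiv_corr: "nderiv m (corr h \<theta>) = (\<lambda>x. (-1) ^ m * corr h (nderiv m \<theta>) x)"
proof -
  define G where "G = (\<lambda>m x. (-1) ^ m * corr h (nderiv m \<theta>) x)"
  have "(G m has_vector_derivative G (Suc m) x) (at x)" for m x
    using has_vector_derivative_mult_right[OF corr_derivative[OF h test_function_nderiv[OF \<theta>, of m], of x], of "(-1) ^ m"]
    by (simp add: G_def nderiv_nderiv)
  from derivative_sequence[of G, OF this]
  have "smooth (G 0)" "nderiv m (G 0) = G m" by simp_all
  moreover have "G 0 = corr h \<theta>" by (simp add: G_def)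
  ultimately show "smooth (corr h \<theta>)" "nderiv m (corr h \<theta>) = (\<lambda>x. (-1) ^ m * corr h (nderiv m \<theta>) x)"
    by (simp_all add: G_def)
qed

text \<open>The \<open>(m + r)\<close>-th derivative of \<open>\<phi>\<^sub>\<epsilon>\<close> is \<open>O(\<epsilon> ^ -(m + r + 1))\<close>, and for \<open>\<epsilon> \<le> 1\<close> the supports of all \<open>\<phi>\<^sub>\<epsilon>\<close>
lie in a common interval.\<close>

lemma corr_moderate:
  assumes h: "loc_integrable h"
    and f: "\<And>\<phi>. \<phi> \<in> test_functions \<Longrightarrow> f \<phi> = (\<lambda>x. c * corr h (nderiv r \<phi>) x)"
  shows "f \<in> E_moderate"
  unfolding E_moderate_iff
proof (intro conjI allI impI)
  show "f \<in> E_space"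
    unfolding E_space_def
    by (auto simp: f A_space_test_function intro!: smooth_cmult smooth_corr h test_function_nderiv)
  fix K :: "real set" and m assume "compact K"
  then obtain M where "M > 0" and M: "\<And>x. x \<in> K \<Longrightarrow> \<bar>x\<bar> \<le> M"
    using compact_imp_bounded[of K] unfolding bounded_pos by auto
  define q where "q = Suc (m + r)"
  have "growth f K m \<phi> (\<lambda>\<epsilon>. 1 / \<epsilon> ^ q)" if "\<phi> \<in> A_space q" for \<phi>
  proof -
    have \<phi>: "\<phi> \<in> test_functions" using that by (rule A_space_test_function)
    from \<phi> obtain R where sm: "smooth \<phi>" and "R > 0" and R: "\<And>x. R < \<bar>x\<bar> \<Longrightarrow> \<phi> x = 0"
      by (auto simp: test_function_iff)
    obtain B where B: "B > 0" "\<And>x. norm (nderiv (m + r) \<phi> x) \<le> B"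
      using test_function_bounded[OF test_function_nderiv[OF \<phi>]] by blast
    define I where "I = (\<integral>y\<in>{-(R+M)..R+M}. \<bar>h y\<bar> \<partial>lborel)"
    have "norm (nderiv m (f (rescale \<epsilon> \<phi>)) x) \<le> (norm c * (B * \<bar>I\<bar>)) * (1 / \<epsilon> ^ q)"
      if \<epsilon>: "0 < \<epsilon>" "\<epsilon> \<le> 1" and x: "x \<in> K" for \<epsilon> x
    proof -
      have r\<phi>: "rescale \<epsilon> \<phi> \<in> test_functions" using \<phi> \<epsilon>(1) by (rule rescale_test_function)
      note rd = test_function_nderiv[OF r\<phi>]
      have eq: "nderiv (m + r) (rescale \<epsilon> \<phi>) = (\<lambda>x. of_real ((1 / \<epsilon>) ^ q) * nderiv (m + r) \<phi> (x / \<epsilon>))"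
        unfolding nderiv_rescale[OF sm] q_def ..
      have norm_eq: "norm (nderiv m (f (rescale \<epsilon> \<phi>)) x) = norm c * norm (corr h (nderiv (m + r) (rescale \<epsilon> \<phi>)) x)"
        unfolding f[OF r\<phi>] nderiv_cmult[OF smooth_corr[OF h rd]] nderiv_corr[OF h rd]
        by (simp add: nderiv_nderiv norm_mult norm_power)
      have "norm (corr h (nderiv (m + r) (rescale \<epsilon> \<phi>)) x) \<le> (B * (1 / \<epsilon> ^ q)) * I"
        unfolding I_def
      proof (rule corr_integrable_bound(4)[OF h])
        show "nderiv (m + r) (rescale \<epsilon> \<phi>) \<in> borel_measurable borel"
          by (rule test_function_measurable[OF rd])
        show "norm (nderiv (m + r) (rescale \<epsilon> \<phi>) y) \<le> B * (1 / \<epsilon> ^ q)" for y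
        proof -
          have "norm (of_real ((1 / \<epsilon>) ^ q) :: complex) = 1 / \<epsilon> ^ q"
            unfolding norm_of_real using \<epsilon>(1) by (simp add: power_one_over)
          then show ?thesis
            using mult_right_mono[OF B(2)[of "y / \<epsilon>"], of "1 / \<epsilon> ^ q"] \<epsilon>(1)
            unfolding eq norm_mult by (simp only: mult.commute) simp
        qed
        show "nderiv (m + r) (rescale \<epsilon> \<phi>) y = 0" if "R < \<bar>y\<bar>" for y
        proof -
          have "\<bar>y\<bar> \<le> \<bar>y / \<epsilon>\<bar>"
            using \<epsilon> mult_left_mono[of \<epsilon> 1 "\<bar>y\<bar>"] by (simp add: pos_le_divide_eq)
          then have "R < \<bar>y / \<epsilon>\<bar>" using that by linarith
          then have "nderiv (m + r) \<phi> (y / \<epsilon>) = 0" using nderiv_outside[of R \<phi>] R by blast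
          then show ?thesis unfolding eq by simp
        qed
        show "\<bar>x\<bar> \<le> M" by (rule M[OF x])
      qed
      also have "\<dots> \<le> (B * (1 / \<epsilon> ^ q)) * \<bar>I\<bar>"
        using B(1) \<epsilon> by (intro mult_left_mono) auto
      finally show ?thesis
        unfolding norm_eq by (rule order_trans[OF mult_left_mono]) (simp_all add: mult_ac)
    qed
    then have "\<forall>\<^sub>F \<epsilon> in at_right 0. \<forall>x\<in>K. norm (nderiv m (f (rescale \<epsilon> \<phi>)) x) \<le> (norm c * (B * \<bar>I\<bar>)) * (1 / \<epsilon> ^ q)"
      by (intro eventually_mono[OF eventually_at_right_0_pos]) blast
    then show ?thesis
      unfolding growth_def using B(1) by (intro exI[of _ "norm c * (B * \<bar>I\<bar>)"]) auto
  qed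
  then show "\<exists>q\<ge>1. \<forall>\<phi>\<in>A_space q. growth f K m \<phi> (\<lambda>\<epsilon>. 1 / \<epsilon> ^ q)"
    by (intro exI[of _ q]) (auto simp: q_def)
qed

section \<open>The distributions \<open>\<nu>\<^sub>\<plusminus>\<close> and their smoothings\<close>

lemma nu_minus_fun_reflect: "nu_minus_fun a x = nu_plus_fun a (- x)"
  by (simp add: nu_minus_fun_def nu_plus_fun_def)

lemma nu_plus_fun_measurable [measurable]: "nu_plus_fun a \<in> borel_measurable borel"
  unfolding nu_plus_fun_def by measurable

lemma nu_minus_fun_measurable [measurable]: "nu_minus_fun a \<in> borel_measurable borel"
  unfolding nu_minus_fun_def by measurable

lemma Gamma_plus1_pos: "a > -1 \<Longrightarrow> Gamma (a + 1 :: real) > 0"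
  by (simp add: Gamma_real_pos)

lemma nu_plus_fun_nonneg: "a > -1 \<Longrightarrow> nu_plus_fun a x \<ge> 0"
  using Gamma_plus1_pos[of a] by (simp add: nu_plus_fun_def)

lemma loc_integrable_nu_plus: 
  assumes "a > -1" shows "loc_integrable (nu_plus_fun a)"
  unfolding loc_integrable_def
proof (intro conjI allI)
  fix R :: real
  show "set_integrable lborel {-R..R} (nu_plus_fun a)"
  proof (cases "R \<ge> 0")
    case True
    have "(\<lambda>x. x powr a) absolutely_integrable_on {0..R}"
      using integrable_on_powr_from_0[OF assms True] by (intro nonnegative_absolutely_integrable_1) auto
    then have "integrable lborel (\<lambda>x. indicator {0..R} x *\<^sub>R x powr a)"
      unfolding set_integrable_def by (subst (asm) integrable_completion) auto
    then have int: "integrable lborel (\<lambda>x. indicator {0..R} x *\<^sub>R x powr a * inverse (Gamma (a + 1)))"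
      by (rule integrable_mult_left)
    have "integrable lborel (\<lambda>x. indicator {-R..R} x *\<^sub>R nu_plus_fun a x)"
      by (rule Bochner_Integration.integrable_bound[OF int])
        (auto simp: nu_plus_fun_def indicator_def abs_mult divide_inverse)
    then show ?thesis by (simp add: set_integrable_def)
  qed (simp add: set_integrable_def)
qed simp

lemma loc_integrable_reflect: 
  assumes "loc_integrable h" shows "loc_integrable (\<lambda>x. h (- x))"
  unfolding loc_integrable_def
proof (intro conjI allI)
  have [measurable]: "h \<in> borel_measurable borel" using assms by (simp add: loc_integrable_def)
  show "(\<lambda>x. h (- x)) \<in> borel_measurable borel" by measurable
  fix R :: real
  have "integrable lborel (\<lambda>x. indicator {-R..R} (0 + -1 * x) *\<^sub>R h (0 + -1 * x))"
    using assms by (intro lborel_integrable_real_affine) (auto simp: loc_integrable_def set_integrable_def)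
  also have "(\<lambda>x. indicator {-R..R} (0 + -1 * x) *\<^sub>R h (0 + -1 * x)) = (\<lambda>x. indicator {-R..R} x *\<^sub>R h (- x))"
    by (auto simp: indicator_def fun_eq_iff)
  finally show "set_integrable lborel {-R..R} (\<lambda>x. h (- x))" by (simp add: set_integrable_def)
qed

lemma loc_integrable_nu_minus: "a > -1 \<Longrightarrow> loc_integrable (nu_minus_fun a)"
  using loc_integrable_reflect[OF loc_integrable_nu_plus[of a]] by (simp add: nu_minus_fun_reflect[abs_def])

lemma nu_order: "a + real (nu_order a) > -1"
proof -
  obtain r :: nat where "-1 - a < real r" using reals_Archimedean2 by blast
  then have "a + real r > -1" by simp
  then show ?thesis unfolding nu_order_def by (rule LeastI)
qed

lemma dist_deriv_power: "(dist_deriv ^^ r) u \<psi> = (-1) ^ r * u (nderiv r \<psi>)"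
proof (induction r arbitrary: \<psi>)
  case (Suc r)
  then show ?case by (simp add: dist_deriv_def nderiv_nderiv)
qed simp

lemma regular_dist_translate:
  assumes "smooth \<phi>"
  shows "regular_dist h (nderiv r (\<lambda>y. \<phi> (- (x - y)))) = corr h (nderiv r \<phi>) x"
proof -
  have "nderiv r (\<lambda>y. \<phi> (1 * y + (- x))) = (\<lambda>y. of_real (1 ^ r) * nderiv r \<phi> (1 * y + (- x)))"
    by (rule nderiv_affine[OF assms])
  then show ?thesis by (simp add: regular_dist_def corr_shift)
qed

lemma convolution_nu_plus:
  assumes "\<phi> \<in> test_functions"
  shows "dist_convolution (nu_plus a) (\<lambda>y. \<phi> (- y)) =
    (\<lambda>x. (-1) ^ nu_order a * corr (nu_plus_fun (a + real (nu_order a))) (nderiv (nu_order a) \<phi>) x)"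
  unfolding dist_convolution_def nu_plus_def dist_deriv_power
    regular_dist_translate[OF test_function_smooth[OF assms]] ..

lemma convolution_nu_minus:
  assumes "\<phi> \<in> test_functions"
  shows "dist_convolution (nu_minus a) (\<lambda>y. \<phi> (- y)) =
    (\<lambda>x. 1 * corr (nu_minus_fun (a + real (nu_order a))) (nderiv (nu_order a) \<phi>) x)"
  unfolding dist_convolution_def nu_minus_def dist_deriv_power
    regular_dist_translate[OF test_function_smooth[OF assms]]
  by (simp flip: power_mult_distrib mult.assoc)

lemma convolution_nu_plus_moderate:
  "(\<lambda>\<phi>. dist_convolution (nu_plus a) (\<lambda>y. \<phi> (- y))) \<in> E_moderate"
  by (rule corr_moderate[OF loc_integrable_nu_plus[OF nu_order]]) (rule convolution_nu_plus)

lemma convolution_nu_minus_moderate: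
  "(\<lambda>\<phi>. dist_convolution (nu_minus a) (\<lambda>y. \<phi> (- y))) \<in> E_moderate"
  by (rule corr_moderate[OF loc_integrable_nu_minus[OF nu_order]]) (rule convolution_nu_minus)

lemma nu_plus_fun_scale: "\<epsilon> > 0 \<Longrightarrow> nu_plus_fun a (\<epsilon> * x) = \<epsilon> powr a * nu_plus_fun a x"
  by (simp add: nu_plus_fun_def powr_mult zero_less_mult_iff)

lemma nu_minus_fun_scale: "\<epsilon> > 0 \<Longrightarrow> nu_minus_fun a (\<epsilon> * x) = \<epsilon> powr a * nu_minus_fun a x"
  using nu_plus_fun_scale[of \<epsilon> a "- x"] by (simp add: nu_minus_fun_reflect)

text \<open>If \<open>h\<close> is homogeneous of degree \<open>a\<close>, the smoothing of its \<open>r\<close>-th derivative is homogeneous of degree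
\<open>a - r\<close> under simultaneous scaling of the mollifier and of the argument.\<close>

lemma corr_rescale:
  assumes \<epsilon>: "\<epsilon> > 0" and \<phi>: "smooth \<phi>"
    and h: "\<And>x. h (\<epsilon> * x) = \<epsilon> powr a * h x"
  shows "corr h (nderiv r (rescale \<epsilon> \<phi>)) x = of_real (\<epsilon> powr (a - real r)) * corr h (nderiv r \<phi>) (x / \<epsilon>)"
proof -
  have "corr h (nderiv r (rescale \<epsilon> \<phi>)) x =
      (\<integral>u. of_real (h (x + u)) * (of_real ((1 / \<epsilon>) ^ Suc r) * nderiv r \<phi> (u / \<epsilon>)) \<partial>lborel)"
    by (simp only: corr_def nderiv_rescale[OF \<phi>])
  also have "\<dots> = of_real \<epsilon> * (\<integral>u. of_real (h (x + \<epsilon> * u)) * (of_real ((1 / \<epsilon>) ^ Suc r) * nderiv r \<phi> u) \<partial>lborel)"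
    using \<epsilon> by (subst lborel_integral_real_affine[of \<epsilon> _ 0]) (simp_all add: scaleR_conv_of_real)
  also have "\<dots> = of_real \<epsilon> * (\<integral>u. of_real ((1 / \<epsilon>) ^ Suc r * \<epsilon> powr a) * (of_real (h (x / \<epsilon> + u)) * nderiv r \<phi> u) \<partial>lborel)"
  proof -
    \<comment> \<open>homogeneity applied to \<open>x + \<epsilon> u = \<epsilon> (x / \<epsilon> + u)\<close>\<close>
    have "h (x + \<epsilon> * u) = \<epsilon> powr a * h (x / \<epsilon> + u)" for u
      using h[of "x / \<epsilon> + u"] \<epsilon> by (simp add: distrib_left)
    then show ?thesis by (simp add: mult_ac)
  qed
  also have "\<dots> = of_real (\<epsilon> * ((1 / \<epsilon>) ^ Suc r * \<epsilon> powr a)) * corr h (nderiv r \<phi>) (x / \<epsilon>)"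
    by (simp add: corr_def del: power_Suc)
  also have "\<epsilon> * ((1 / \<epsilon>) ^ Suc r * \<epsilon> powr a) = \<epsilon> powr (a - real r)"
    using \<epsilon> by (simp add: powr_diff powr_realpow power_one_over)
  finally show ?thesis .
qed

text \<open>\<open>\<nu>\<^sub>+\<close> lives on the right half-line and \<open>\<nu>\<^sub>-\<close> on the left one, so a product of a smoothing of \<open>\<nu>\<^sub>+\<close> with one of
\<open>\<nu>\<^sub>-\<close> has compact support although neither factor does.\<close>

lemma corr_nu_plus_outside:
  assumes "\<And>x. R < \<bar>x\<bar> \<Longrightarrow> \<theta> x = 0" "x < -R"
  shows "corr (nu_plus_fun a) \<theta> x = 0"
proof -
  have "of_real (nu_plus_fun a (x + u)) * \<theta> u = 0" for u
    using assms by (cases "R < \<bar>u\<bar>") (auto simp: nu_plus_fun_def)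
  then show ?thesis unfolding corr_def by (simp only: Bochner_Integration.integral_zero)
qed

lemma corr_nu_minus_outside:
  assumes "\<And>x. R < \<bar>x\<bar> \<Longrightarrow> \<theta> x = 0" "x > R"
  shows "corr (nu_minus_fun a) \<theta> x = 0"
proof -
  have "of_real (nu_minus_fun a (x + u)) * \<theta> u = 0" for u
    using assms by (cases "R < \<bar>u\<bar>") (auto simp: nu_minus_fun_def)
  then show ?thesis unfolding corr_def by (simp only: Bochner_Integration.integral_zero)
qed

section \<open>Beta integrals and their gluing along the diagonal\<close>

text \<open>Euler's beta integral. The factors \<open>1 / \<Gamma>(a + 1)\<close> in the definition of \<open>\<nu>\<^sub>+\<close> are chosen so that the functions
\<open>\<nu>\<^sub>+\<^sup>a\<close> form a convolution semigroup after a shift of the exponent by one.\<close>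

lemma nu_convolution:
  assumes a: "a > -1" and b: "b > -1"
  shows "has_bochner_integral lborel (\<lambda>t. nu_plus_fun a (t + u) * nu_minus_fun b (t + v))
    (nu_plus_fun (a + b + 1) (u - v))"
proof (cases "v < u")
  case False
  then have "nu_plus_fun a (t + u) * nu_minus_fun b (t + v) = 0" for t
    by (simp add: nu_plus_fun_def nu_minus_fun_def)
  moreover have "nu_plus_fun (a + b + 1) (u - v) = 0" using False by (simp add: nu_plus_fun_def)
  ultimately show ?thesis by (simp only: has_bochner_integral_zero)
next
  case True
  define w where "w = u - v"
  have w: "w > 0" using True by (simp add: w_def)
  let ?c = "Gamma (a + 1) * Gamma (b + 1)"
  have c: "?c > 0" using Gamma_plus1_pos a b by simp
  define f where "f s = nu_plus_fun a s * nu_plus_fun b (1 - s)" for s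
  have f_eq: "f s = (if s \<in> {0..1} then s powr (a + 1 - 1) * (1 - s) powr (b + 1 - 1) / ?c else 0)" for s
    by (auto simp: f_def nu_plus_fun_def)
  have "((\<lambda>s. s powr (a + 1 - 1) * (1 - s) powr (b + 1 - 1) / ?c) has_integral Beta (a + 1) (b + 1) / ?c) {0..1}"
    using a b by (intro has_integral_divide has_integral_Beta_real) auto
  then have int: "(f has_integral Beta (a + 1) (b + 1) / ?c) UNIV"
    unfolding f_eq[abs_def] has_integral_restrict_UNIV .
  have [measurable]: "f \<in> borel_measurable borel" unfolding f_def by measurable
  have f0: "f s \<ge> 0" for s unfolding f_def using a b by (intro mult_nonneg_nonneg nu_plus_fun_nonneg)
  have beta: "Beta (a + 1) (b + 1) / ?c = 1 / Gamma (a + b + 2)"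
    using Gamma_plus1_pos[OF a, THEN less_imp_neq] Gamma_plus1_pos[OF b, THEN less_imp_neq]
    by (simp add: Beta_def add_ac)
  have "Gamma (a + b + 2) > 0" using a b by (simp add: Gamma_real_pos)
  then have "has_bochner_integral lborel f (1 / Gamma (a + b + 2))"
    using nn_integral_has_integral_lborel[OF _ f0 int] f0
    unfolding beta by (intro has_bochner_integral_nn_integral) auto
  then have "has_bochner_integral lborel (\<lambda>s. w powr (a + b) * f s) (w powr (a + b) * (1 / Gamma (a + b + 2)))"
    by (rule has_bochner_integral_mult_right)
  \<comment> \<open>the substitution \<open>t = -u + w s\<close> maps the unit interval onto \<open>{-u..-v}\<close>, the support of the integrand\<close>
  also have "(\<lambda>s. w powr (a + b) * f s) = (\<lambda>s. nu_plus_fun a (- u + w * s + u) * nu_minus_fun b (- u + w * s + v))"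
  proof
    fix s
    have "nu_plus_fun a (- u + w * s + u) = w powr a * nu_plus_fun a s"
      using nu_plus_fun_scale[OF w, of a s] by simp
    moreover have "- (- u + w * s + v) = w * (1 - s)" by (simp add: w_def algebra_simps)
    then have "nu_minus_fun b (- u + w * s + v) = w powr b * nu_plus_fun b (1 - s)"
      unfolding nu_minus_fun_reflect using nu_plus_fun_scale[OF w, of b "1 - s"] by simp
    ultimately show "w powr (a + b) * f s = nu_plus_fun a (- u + w * s + u) * nu_minus_fun b (- u + w * s + v)"
      by (simp add: f_def powr_add)
  qed
  also have "w powr (a + b) * (1 / Gamma (a + b + 2)) = nu_plus_fun (a + b + 1) (u - v) /\<^sub>R \<bar>w\<bar>"
    using w by (simp add: nu_plus_fun_def flip: w_def) (simp add: powr_add field_simps)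
  finally show ?thesis
    using w by (subst lborel_has_bochner_integral_real_affine_iff[of w _ _ "-u"]) simp_all
qed

lemma power_mult_nu_plus:
  assumes "a > -1"
  shows "y ^ k * nu_plus_fun a y = pochhammer (a + 1) k * nu_plus_fun (a + real k) y"
proof (cases "y > 0")
  case True
  have "a + 1 > 0" using assms by simp
  then have "a + 1 \<notin> \<int>\<^sub>\<le>\<^sub>0" by (auto elim!: nonpos_Ints_cases)
  then have "pochhammer (a + 1) k = Gamma (a + 1 + real k) / Gamma (a + 1)"
    by (rule pochhammer_Gamma)
  moreover have "Gamma (a + 1 + real k) > 0" using \<open>a + 1 > 0\<close> by (simp add: Gamma_real_pos)
  ultimately show ?thesis
    using True by (simp add: nu_plus_fun_def powr_add powr_realpow add_ac)
qed (simp add: nu_plus_fun_def)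

text \<open>The result of integrating \<open>t ^ j * \<nu>\<^sub>+\<^sup>a(t + u) * \<nu>\<^sub>-\<^sup>b(t + v)\<close> over \<open>t\<close> when \<open>a + b + 1 = n\<close> is a natural number. It arises by
expanding \<open>t = (t + u) - u\<close>: powers of \<open>t + u\<close> only raise the exponent of \<open>\<nu>\<^sub>+\<close>.\<close>

definition nu_kernel :: "real \<Rightarrow> nat \<Rightarrow> nat \<Rightarrow> real \<Rightarrow> real \<Rightarrow> real" where
  "nu_kernel a n j u v = (\<Sum>k\<le>j. of_nat (j choose k) * (- u) ^ (j - k) * pochhammer (a + 1) k * nu_plus_fun (real (n + k)) (u - v))"

lemma kernel_integral_plus_minus:
  assumes a: "a > -1" and b: "b > -1" and n: "a + b + 1 = real n"
  shows "has_bochner_integral lborel (\<lambda>t. t ^ j * (nu_plus_fun a (t + u) * nu_minus_fun b (t + v))) (nu_kernel a n j u v)"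
proof -
  have "has_bochner_integral lborel
     (\<lambda>t. \<Sum>k\<le>j. of_nat (j choose k) * (- u) ^ (j - k) * pochhammer (a + 1) k * (nu_plus_fun (a + real k) (t + u) * nu_minus_fun b (t + v)))
     (nu_kernel a n j u v)"
    unfolding nu_kernel_def
  proof (intro has_bochner_integral_sum has_bochner_integral_mult_right)
    fix k
    have "a + real k + b + 1 = real (n + k)" using n by simp
    moreover have "a + real k > -1" using a by simp
    ultimately show "has_bochner_integral lborel (\<lambda>t. nu_plus_fun (a + real k) (t + u) * nu_minus_fun b (t + v)) (nu_plus_fun (real (n + k)) (u - v))"
      using nu_convolution[OF _ b, of "a + real k" u v] by (simp only:)
  qed
  also have "(\<lambda>t. \<Sum>k\<le>j. of_nat (j choose k) * (- u) ^ (j - k) * pochhammer (a + 1) k * (nu_plus_fun (a + real k) (t + u) * nu_minus_fun b (t + v)))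
     = (\<lambda>t. t ^ j * (nu_plus_fun a (t + u) * nu_minus_fun b (t + v)))"
  proof
    fix t
    have "t ^ j = ((t + u) + (- u)) ^ j" by simp
    also have "\<dots> = (\<Sum>k\<le>j. of_nat (j choose k) * (t + u) ^ k * (- u) ^ (j - k))"
      by (rule binomial_ring)
    finally have tj: "t ^ j = (\<Sum>k\<le>j. of_nat (j choose k) * (t + u) ^ k * (- u) ^ (j - k))" .
    have tj': "t ^ j * (nu_plus_fun a (t + u) * nu_minus_fun b (t + v)) =
        (\<Sum>k\<le>j. of_nat (j choose k) * (- u) ^ (j - k) * ((t + u) ^ k * nu_plus_fun a (t + u)) * nu_minus_fun b (t + v))"
      unfolding tj sum_distrib_right by (simp add: mult_ac)
    show "(\<Sum>k\<le>j. of_nat (j choose k) * (- u) ^ (j - k) * pochhammer (a + 1) k * (nu_plus_fun (a + real k) (t + u) * nu_minus_fun b (t + v)))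
       = t ^ j * (nu_plus_fun a (t + u) * nu_minus_fun b (t + v))"
      unfolding tj' power_mult_nu_plus[OF a] by (simp only: mult.assoc)
  qed
  finally show ?thesis .
qed

text \<open>The reflection \<open>t \<mapsto> -t\<close> exchanges \<open>\<nu>\<^sub>+\<close> and \<open>\<nu>\<^sub>-\<close>.\<close>

lemma kernel_integral_minus_plus:
  assumes a: "a > -1" and b: "b > -1" and n: "a + b + 1 = real n"
  shows "has_bochner_integral lborel (\<lambda>t. t ^ j * (nu_minus_fun a (t + u) * nu_plus_fun b (t + v)))
    ((-1) ^ j * nu_kernel a n j (- u) (- v))"
proof (subst lborel_has_bochner_integral_real_affine_iff[of "-1" _ _ 0])
  have "(\<lambda>t. (-1) ^ j * (t ^ j * (nu_plus_fun a (t + - u) * nu_minus_fun b (t + - v)))) =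
      (\<lambda>x. (0 + -1 * x) ^ j * (nu_minus_fun a (0 + -1 * x + u) * nu_plus_fun b (0 + -1 * x + v)))"
  proof
    fix x :: real
    have "(0 + -1 * x) ^ j = (-1) ^ j * x ^ j" by (simp only: add_0 power_mult_distrib)
    then show "(-1) ^ j * (x ^ j * (nu_plus_fun a (x + - u) * nu_minus_fun b (x + - v))) =
      (0 + -1 * x) ^ j * (nu_minus_fun a (0 + -1 * x + u) * nu_plus_fun b (0 + -1 * x + v))"
      by (simp add: nu_minus_fun_reflect)
  qed
  with has_bochner_integral_mult_right[OF kernel_integral_plus_minus[OF a b n, of j "-u" "-v"], of "(-1) ^ j"]
  show "has_bochner_integral lborel (\<lambda>x. (0 + -1 * x) ^ j * (nu_minus_fun a (0 + -1 * x + u) * nu_plus_fun b (0 + -1 * x + v)))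
     ((-1) ^ j * nu_kernel a n j (- u) (- v) /\<^sub>R \<bar>-1\<bar>)"
    by simp
qed simp

text \<open>For a natural exponent \<open>\<nu>\<^sub>+\<^sup>m\<close> is one half of a polynomial. At \<open>w = 0\<close> the identity fails for \<open>m = 0\<close>, since
both halves are set to \<open>0\<close> there.\<close>

lemma nu_plus_fun_nat_glue:
  assumes "w \<noteq> 0"
  shows "nu_plus_fun (real m) w + (-1) ^ m * nu_plus_fun (real m) (- w) = w ^ m / fact m"
proof -
  have "Gamma (real m + 1) = fact m" by (simp add: Gamma_fact add.commute)
  moreover have "(-1) ^ m * (- w) ^ m = w ^ m"
    unfolding power_mult_distrib[symmetric] by simp
  ultimately show ?thesis
    using assms by (cases "w > 0") (auto simp: nu_plus_fun_def powr_realpow)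
qed

text \<open>The crucial cancellation of singularities: with the relative sign \<open>(-1) ^ n\<close>, which is what \<open>(-1) ^ p\<close> in the
theorem becomes, the two kernels fit together along the diagonal to a polynomial that is homogeneous
of degree \<open>n + j\<close>.\<close>

lemma kernel_glue:
  assumes "u \<noteq> v"
  shows "nu_kernel a n j u v + (-1) ^ n * ((-1) ^ j * nu_kernel a n j (- u) (- v)) =
    (\<Sum>k\<le>j. of_nat (j choose k) * (- u) ^ (j - k) * pochhammer (a + 1) k / fact (n + k) * (u - v) ^ (n + k))"
proof -
  have "nu_kernel a n j u v + (-1) ^ n * ((-1) ^ j * nu_kernel a n j (- u) (- v)) =
    (\<Sum>k\<le>j. of_nat (j choose k) * (- u) ^ (j - k) * pochhammer (a + 1) k * 
       (nu_plus_fun (real (n + k)) (u - v) + (-1) ^ (n + k) * nu_plus_fun (real (n + k)) (- (u - v))))"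
    unfolding nu_kernel_def sum_distrib_left sum.distrib[symmetric]
  proof (rule sum.cong[OF refl])
    fix k assume "k \<in> {..j}"
    then have "(-1::real) ^ j = (-1) ^ (j - k) * (-1) ^ k"
      by (simp flip: power_add)
    then show "of_nat (j choose k) * (- u) ^ (j - k) * pochhammer (a + 1) k * nu_plus_fun (real (n + k)) (u - v) +
        (-1) ^ n * ((-1) ^ j * (of_nat (j choose k) * (- (- u)) ^ (j - k) * pochhammer (a + 1) k * nu_plus_fun (real (n + k)) (- u - - v))) =
      of_nat (j choose k) * (- u) ^ (j - k) * pochhammer (a + 1) k * 
       (nu_plus_fun (real (n + k)) (u - v) + (-1) ^ (n + k) * nu_plus_fun (real (n + k)) (- (u - v)))"
      by (simp add: power_minus[of u] power_add algebra_simps)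
  qed
  also have "\<dots> = (\<Sum>k\<le>j. of_nat (j choose k) * (- u) ^ (j - k) * pochhammer (a + 1) k / fact (n + k) * (u - v) ^ (n + k))"
  proof -
    have "u - v \<noteq> 0" using assms by simp
    show ?thesis unfolding nu_plus_fun_nat_glue[OF \<open>u - v \<noteq> 0\<close>] by (simp add: mult_ac)
  qed
  finally show ?thesis .
qed

text \<open>The coefficient of \<open>u ^ r * v ^ s\<close> in \<open>u ^ (p - k) * (u + v) ^ (n + k) / (n + k)!\<close>, multiplied by the factor
\<open>r! * s!\<close> that comes from the moments and brought into the form required by Vandermonde's identity. Both sides vanish when that monomial does not occur in the \<open>k\<close>-th summand.\<close>

lemma choose_times_fact:
  assumes "r + s = n + p" "k \<le> p" 
  shows "(if s \<le> n + k then real (n + k choose s) * fact s * fact r / fact (n + k) else 0) = 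
    fact (p - k) * real (r choose (p - k))"
proof (cases "s \<le> n + k")
  case True
  then have "n + k - s = r - (p - k)" "p - k \<le> r" using assms by auto
  then show ?thesis using True by (simp add: binomial_fact)
next
  case False
  then have "r < p - k" using assms by auto
  then show ?thesis using False by (simp add: binomial_eq_0)
qed

text \<open>Vandermonde's identity for \<open>(-c - 1) + r = -(a + 1)\<close>: the auxiliary number \<open>r\<close> of derivatives disappears
from the result.\<close>

lemma vandermonde_pochhammer:
  fixes a c :: real
  assumes "c = a + real r"
  shows "(\<Sum>k\<le>p. of_nat (p choose k) * (-1) ^ k * pochhammer (c + 1) k * (fact (p - k) * real (r choose (p - k)))) =
    (-1) ^ p * fact p * ((a + real p) gchoose p)"
proof -
  have "(\<Sum>k\<le>p. of_nat (p choose k) * (-1) ^ k * pochhammer (c + 1) k * (fact (p - k) * real (r choose (p - k)))) =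
      (\<Sum>k\<le>p. fact p * (((- c - 1) gchoose k) * (real r gchoose (p - k))))"
  proof (rule sum.cong[OF refl])
    fix k assume "k \<in> {..p}"
    then have "real (p choose k) = fact p / (fact k * fact (p - k))" by (simp add: binomial_fact)
    then show "of_nat (p choose k) * (-1) ^ k * pochhammer (c + 1) k * (fact (p - k) * real (r choose (p - k))) =
        fact p * (((- c - 1) gchoose k) * (real r gchoose (p - k)))"
      by (simp add: gbinomial_pochhammer[of "- c - 1"] binomial_gbinomial add.commute)
  qed
  also have "\<dots> = fact p * ((- c - 1 + real r) gchoose p)"
    using gbinomial_Vandermonde[of "- c - 1" "real r" p] by (simp add: sum_distrib_left[symmetric] atMost_atLeast0)
  also have "- c - 1 + real r = - (a + 1)" using assms by simp
  also have "(- (a + 1)) gchoose p = (-1) ^ p * ((a + real p) gchoose p)"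
    by (subst gbinomial_minus) (simp add: add_ac)
  finally show ?thesis by simp
qed

section \<open>Moments of the product\<close>

lemma
  fixes f g :: "real \<Rightarrow> 'a::{real_normed_field,banach,second_countable_topology}"
  assumes f: "integrable lborel f" and g: "integrable lborel g"
  shows integrable_tensor: "integrable (lborel \<Otimes>\<^sub>M lborel) (\<lambda>(u, v). f u * g v)"
    and integral_tensor: "(\<integral>(u, v). f u * g v \<partial>(lborel \<Otimes>\<^sub>M lborel)) = (\<integral>u. f u \<partial>lborel) * (\<integral>v. g v \<partial>lborel)"
proof -
  note [measurable] = borel_measurable_integrable[OF f] borel_measurable_integrable[OF g]
  show int: "integrable (lborel \<Otimes>\<^sub>M lborel) (\<lambda>(u, v). f u * g v)"
  proof (rule lborel_pair.Fubini_integrable)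
    show "(\<lambda>(u, v). f u * g v) \<in> borel_measurable (lborel \<Otimes>\<^sub>M lborel)" by measurable
    show "integrable lborel (\<lambda>u. \<integral>v. norm (case (u, v) of (u, v) \<Rightarrow> f u * g v) \<partial>lborel)"
      using f by (simp add: norm_mult)
    show "AE u in lborel. integrable lborel (\<lambda>v. case (u, v) of (u, v) \<Rightarrow> f u * g v)"
      using g by simp
  qed
  have "(\<integral>(u, v). f u * g v \<partial>(lborel \<Otimes>\<^sub>M lborel)) = (\<integral>u. \<integral>v. f u * g v \<partial>lborel \<partial>lborel)"
    using lborel_pair.integral_fst'[OF int] by simp
  also have "\<dots> = (\<integral>u. f u \<partial>lborel) * (\<integral>v. g v \<partial>lborel)"
    by simp
  finally show "(\<integral>(u, v). f u * g v \<partial>(lborel \<Otimes>\<^sub>M lborel)) = (\<integral>u. f u \<partial>lborel) * (\<integral>v. g v \<partial>lborel)" .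
qed

text \<open>Fubini's theorem for the triple integral over \<open>(t, (u, v))\<close>. Integrability holds although \<open>h1\<close> and \<open>h2\<close> may be
unbounded: for fixed \<open>t\<close> the integral over \<open>(u, v)\<close> factorises into two integrals that are bounded uniformly
in \<open>t\<close>, and \<open>t\<close> ranges over a bounded interval because of the hypothesis on the supports.\<close>

lemma
  fixes h1 h2 :: "real \<Rightarrow> real" and K :: "real \<Rightarrow> real \<Rightarrow> real"
  assumes h1: "loc_integrable h1" and h2: "loc_integrable h2"
    and g1: "g1 \<in> test_functions" and g2: "g2 \<in> test_functions"
    and R1: "\<And>u. R < \<bar>u\<bar> \<Longrightarrow> g1 u = 0" and R2: "\<And>v. R < \<bar>v\<bar> \<Longrightarrow> g2 v = 0"
    and van: "\<And>t u v. \<bar>u\<bar> \<le> R \<Longrightarrow> \<bar>v\<bar> \<le> R \<Longrightarrow> R < \<bar>t\<bar> \<Longrightarrow> h1 (t + u) * h2 (t + v) = 0"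
    and K: "\<And>u v. has_bochner_integral lborel (\<lambda>t. t ^ j * (h1 (t + u) * h2 (t + v))) (K u v)"
  shows integrable_kernel: "integrable (lborel \<Otimes>\<^sub>M lborel) (\<lambda>(u, v). of_real (K u v) * (g1 u * g2 v))"
    and moment_corr_mult: "moment j (\<lambda>t. corr h1 g1 t * corr h2 g2 t) =
      (\<integral>(u, v). of_real (K u v) * (g1 u * g2 v) \<partial>(lborel \<Otimes>\<^sub>M lborel))"
proof -
  define M where "M = (lborel \<Otimes>\<^sub>M lborel :: (real \<times> real) measure)"
  interpret M: pair_sigma_finite lborel M
    unfolding M_def lborel_prod ..
  note [measurable] = test_function_measurable[OF g1] test_function_measurable[OF g2]
  have [measurable]: "h1 \<in> borel_measurable borel" "h2 \<in> borel_measurable borel"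
    using h1 h2 by (simp_all add: loc_integrable_def)
  obtain B1 where B1: "\<And>x. norm (g1 x) \<le> B1" using test_function_bounded[OF g1] by blast
  obtain B2 where B2: "\<And>x. norm (g2 x) \<le> B2" using test_function_bounded[OF g2] by blast
  define F where "F t uv = (case uv of (u, v) \<Rightarrow> (of_real (t ^ j * (h1 (t + u) * h2 (t + v))) * (g1 u * g2 v) :: complex))" for t uv
  have F_eq: "F t = (\<lambda>(u, v). of_real (t ^ j) * ((of_real (h1 (t + u)) * g1 u) * (of_real (h2 (t + v)) * g2 v)))" for t
    by (auto simp: F_def fun_eq_iff)
  have F0: "F t uv = 0" if "R < \<bar>t\<bar>" for t uv
  proof (cases uv)
    case (Pair u v)
    show ?thesis
      using R1[of u] R2[of v] van[of u v t] that
      by (cases "\<bar>u\<bar> \<le> R"; cases "\<bar>v\<bar> \<le> R") (auto simp: F_def Pair not_le)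
  qed
  have Fm: "case_prod F \<in> borel_measurable (lborel \<Otimes>\<^sub>M M)"
    unfolding F_def M_def case_prod_unfold by measurable
  have i1: "integrable lborel (\<lambda>u. of_real (h1 (t + u)) * g1 u)" for t
    by (rule corr_integrable_bound(2)[OF h1 _ B1 R1 order_refl]) measurable
  have i2: "integrable lborel (\<lambda>v. of_real (h2 (t + v)) * g2 v)" for t
    by (rule corr_integrable_bound(2)[OF h2 _ B2 R2 order_refl]) measurable
  have iF: "integrable M (F t)" for t
    unfolding F_eq M_def case_prod_unfold
    using integrable_mult_right[OF integrable_tensor[OF i1[of t] i2[of t]], of "of_real (t ^ j)"]
    by (simp add: case_prod_unfold)
  define I1 where "I1 = B1 * (\<integral>y\<in>{-(R+R)..R+R}. \<bar>h1 y\<bar> \<partial>lborel)"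
  define I2 where "I2 = B2 * (\<integral>y\<in>{-(R+R)..R+R}. \<bar>h2 y\<bar> \<partial>lborel)"
  have nF: "(\<integral>uv. norm (F t uv) \<partial>M) \<le> \<bar>R\<bar> ^ j * (I1 * I2)" if t: "\<bar>t\<bar> \<le> R" for t
  proof -
    have le1: "(\<integral>u. norm (of_real (h1 (t + u)) * g1 u) \<partial>lborel) \<le> I1"
      unfolding I1_def by (rule corr_integrable_bound(3)[OF h1 _ B1 R1 t]) measurable
    have le2: "(\<integral>v. norm (of_real (h2 (t + v)) * g2 v) \<partial>lborel) \<le> I2"
      unfolding I2_def by (rule corr_integrable_bound(3)[OF h2 _ B2 R2 t]) measurable
    have "(\<integral>uv. norm (F t uv) \<partial>M) = (\<integral>uv. \<bar>t\<bar> ^ j * (case uv of (u, v) \<Rightarrow>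
        norm (of_real (h1 (t + u)) * g1 u) * norm (of_real (h2 (t + v)) * g2 v)) \<partial>M)"
      by (intro Bochner_Integration.integral_cong) (auto simp: F_eq norm_mult norm_power power_abs)
    also have "\<dots> = \<bar>t\<bar> ^ j * ((\<integral>u. norm (of_real (h1 (t + u)) * g1 u) \<partial>lborel) * (\<integral>v. norm (of_real (h2 (t + v)) * g2 v) \<partial>lborel))"
      unfolding M_def
      using integral_tensor[OF integrable_norm[OF i1[of t]] integrable_norm[OF i2[of t]]] by simp
    also have "\<dots> \<le> \<bar>R\<bar> ^ j * (I1 * I2)"
    proof (intro mult_mono power_mono le1 le2)
      show "0 \<le> I1"
        by (rule order_trans[OF _ le1]) (rule Bochner_Integration.integral_nonneg, simp)
    qed (use t in \<open>auto intro!: mult_nonneg_nonneg Bochner_Integration.integral_nonneg\<close>)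
    finally show ?thesis .
  qed
  have "integrable (lborel \<Otimes>\<^sub>M M) (case_prod F)"
  proof (rule M.Fubini_integrable[OF Fm])
    show "integrable lborel (\<lambda>t. \<integral>uv. norm (case (t, uv) of (t, uv) \<Rightarrow> F t uv) \<partial>M)"
    proof (rule integrableI_bounded_set[where A="{-R..R}" and B="\<bar>R\<bar> ^ j * (I1 * I2)"])
      show "(\<lambda>t. \<integral>uv. norm (case (t, uv) of (t, uv) \<Rightarrow> F t uv) \<partial>M) \<in> borel_measurable lborel"
        using Fm by measurable
      have "norm (\<integral>uv. norm (F t uv) \<partial>M) \<le> \<bar>R\<bar> ^ j * (I1 * I2)" if "t \<in> {-R..R}" for t
        using nF[of t] that by (simp add: abs_le_iff)
      then show "AE t\<in>{-R..R} in lborel. norm (\<integral>uv. norm (case (t, uv) of (t, uv) \<Rightarrow> F t uv) \<partial>M) \<le> \<bar>R\<bar> ^ j * (I1 * I2)"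
        by simp
      have "(\<integral>uv. norm (F t uv) \<partial>M) = 0" if "t \<notin> {-R..R}" for t
      proof -
        have "R < \<bar>t\<bar>" using that by auto
        then show ?thesis using F0 by simp
      qed
      then show "AE t in lborel. t \<notin> {-R..R} \<longrightarrow> (\<integral>uv. norm (case (t, uv) of (t, uv) \<Rightarrow> F t uv) \<partial>M) = 0"
        by simp
    qed (simp_all add: emeasure_lborel_Icc_eq)
    show "AE t in lborel. integrable M (\<lambda>uv. case (t, uv) of (t, uv) \<Rightarrow> F t uv)"
      using iF by simp
  qed
  note int = this
  have inner: "(\<integral>t. F t uv \<partial>lborel) = (case uv of (u, v) \<Rightarrow> of_real (K u v) * (g1 u * g2 v))" for uv
  proof (cases uv)
    case (Pair u v)
    have "(\<integral>t. F t uv \<partial>lborel) = (\<integral>t. of_real (t ^ j * (h1 (t + u) * h2 (t + v))) \<partial>lborel) * (g1 u * g2 v)"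
      unfolding F_def Pair by (simp del: of_real_mult of_real_power)
    also have "(\<integral>t. (of_real (t ^ j * (h1 (t + u) * h2 (t + v))) :: complex) \<partial>lborel) = of_real (K u v)"
      using has_bochner_integral_integral_eq[OF K[of u v]] by (simp only: integral_complex_of_real)
    finally show ?thesis by (simp add: Pair)
  qed
  show "integrable (lborel \<Otimes>\<^sub>M lborel) (\<lambda>(u, v). of_real (K u v) * (g1 u * g2 v))"
    using M.integrable_snd[OF int] unfolding inner by (simp add: M_def case_prod_unfold)
  have outer: "(\<integral>uv. F t uv \<partial>M) = of_real t ^ j * (corr h1 g1 t * corr h2 g2 t)" for t
  proof -
    have "(\<integral>uv. F t uv \<partial>M) = of_real (t ^ j) * (\<integral>uv. (case uv of (u, v) \<Rightarrow>
        (of_real (h1 (t + u)) * g1 u) * (of_real (h2 (t + v)) * g2 v)) \<partial>M)"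
      unfolding F_eq case_prod_unfold by simp
    then show ?thesis
      unfolding M_def integral_tensor[OF i1 i2] corr_def by simp
  qed
  show "moment j (\<lambda>t. corr h1 g1 t * corr h2 g2 t) =
      (\<integral>(u, v). of_real (K u v) * (g1 u * g2 v) \<partial>(lborel \<Otimes>\<^sub>M lborel))"
    using M.Fubini_integral[OF int] unfolding inner outer unfolding M_def moment_def by simp
qed

lemma corr_mult_test_function:
  assumes h: "loc_integrable h1" "loc_integrable h2" and g: "g1 \<in> test_functions" "g2 \<in> test_functions"
    and "\<And>t. R < \<bar>t\<bar> \<Longrightarrow> corr h1 g1 t * corr h2 g2 t = 0"
  shows "(\<lambda>t. corr h1 g1 t * corr h2 g2 t) \<in> test_functions"
proof -
  have "smooth (\<lambda>t. corr h1 g1 t * corr h2 g2 t)"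
    by (intro smooth_mult smooth_corr h g)
  moreover have "\<forall>t. \<bar>R\<bar> + 1 < \<bar>t\<bar> \<longrightarrow> corr h1 g1 t * corr h2 g2 t = 0"
    using assms(5) by auto
  moreover have "\<bar>R\<bar> + 1 > 0" by simp
  ultimately show ?thesis unfolding test_function_iff by blast
qed

lemma
  assumes f: "f \<in> test_functions" and g: "g \<in> test_functions" and P: "\<And>u v. P u v = (\<Sum>x\<in>X. c x * u ^ d x * v ^ e x)"
  shows integrable_polynomial_tensor: "integrable (lborel \<Otimes>\<^sub>M lborel) (\<lambda>(u, v). of_real (P u v) * (f u * g v))"
    and integral_polynomial_tensor: "(\<integral>(u, v). of_real (P u v) * (f u * g v) \<partial>(lborel \<Otimes>\<^sub>M lborel)) =
      (\<Sum>x\<in>X. of_real (c x) * (moment (d x) f * moment (e x) g))"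
proof -
  have eq: "(\<lambda>(u, v). of_real (P u v) * (f u * g v)) =
    (\<lambda>w. \<Sum>x\<in>X. of_real (c x) * (case w of (u, v) \<Rightarrow> (of_real u ^ d x * f u) * (of_real v ^ e x * g v)))"
    by (auto simp: P fun_eq_iff sum_distrib_right sum_distrib_left mult_ac)
  have i: "integrable lborel (\<lambda>u. of_real u ^ d x * f u)" "integrable lborel (\<lambda>v. of_real v ^ e x * g v)" for x
    by (intro test_function_integrable test_function_power_mult f g)+
  show "integrable (lborel \<Otimes>\<^sub>M lborel) (\<lambda>(u, v). of_real (P u v) * (f u * g v))"
    unfolding eq by (intro Bochner_Integration.integrable_sum integrable_mult_right integrable_tensor i)
  show "(\<integral>(u, v). of_real (P u v) * (f u * g v) \<partial>(lborel \<Otimes>\<^sub>M lborel)) =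
      (\<Sum>x\<in>X. of_real (c x) * (moment (d x) f * moment (e x) g))"
    unfolding eq
    by (subst Bochner_Integration.integral_sum)
      (intro integrable_mult_right integrable_tensor i, simp add: integral_tensor[OF i] moment_def)
qed

text \<open>Expanding the glued polynomial into monomials \<open>u ^ (j + n - l) * v ^ l\<close> turns the double integral into a
combination of products of moments.\<close>

lemma integral_glued_polynomial:
  fixes b :: "nat \<Rightarrow> real" and n :: nat
  assumes \<phi>: "\<phi> \<in> test_functions"
  defines "P \<equiv> \<lambda>j u v. \<Sum>k\<le>j. b k * (- u) ^ (j - k) * (u - v) ^ (n + k)"
  shows "(\<integral>(u, v). of_real (P j u v) * (nderiv r \<phi> u * nderiv s \<phi> v) \<partial>(lborel \<Otimes>\<^sub>M lborel)) =
    (\<Sum>k\<le>j. \<Sum>l\<le>n + k. of_real (b k * (-1) ^ (j - k) * (-1) ^ l * of_nat (n + k choose l)) *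
       (moment (j + n - l) (nderiv r \<phi>) * moment l (nderiv s \<phi>)))"
    and "integrable (lborel \<Otimes>\<^sub>M lborel) (\<lambda>(u, v). of_real (P j u v) * (nderiv r \<phi> u * nderiv s \<phi> v))"
proof -
  have P_eq: "P j u v = (\<Sum>x\<in>(SIGMA k:{..j}. {..n + k}). (b (fst x) * (-1) ^ (j - fst x) * (-1) ^ snd x * of_nat (n + fst x choose snd x)) *
      u ^ (j + n - snd x) * v ^ snd x)" for u v
  proof -
    have "b k * (- u) ^ (j - k) * (u - v) ^ (n + k) =
      (\<Sum>l\<le>n + k. b k * (-1) ^ (j - k) * (-1) ^ l * of_nat (n + k choose l) * u ^ (j + n - l) * v ^ l)" if "k \<le> j" for k
    proof -
      have "(u - v) ^ (n + k) = (- v + u) ^ (n + k)" by simp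
      also have "\<dots> = (\<Sum>l\<le>n + k. of_nat (n + k choose l) * (- v) ^ l * u ^ (n + k - l))"
        by (rule binomial_ring)
      finally have "b k * (- u) ^ (j - k) * (u - v) ^ (n + k) =
          (\<Sum>l\<le>n + k. b k * (- u) ^ (j - k) * (of_nat (n + k choose l) * (- v) ^ l * u ^ (n + k - l)))"
        by (simp only: sum_distrib_left)
      also have "\<dots> = (\<Sum>l\<le>n + k. b k * (-1) ^ (j - k) * (-1) ^ l * of_nat (n + k choose l) * u ^ (j + n - l) * v ^ l)"
      proof (rule sum.cong[OF refl])
        fix l assume "l \<in> {..n + k}"
        then have "j + n - l = (j - k) + (n + k - l)" using that by auto
        then show "b k * (- u) ^ (j - k) * (of_nat (n + k choose l) * (- v) ^ l * u ^ (n + k - l)) =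
            b k * (-1) ^ (j - k) * (-1) ^ l * of_nat (n + k choose l) * u ^ (j + n - l) * v ^ l"
          by (simp add: power_add power_minus[of u] power_minus[of v])
      qed
      finally show ?thesis .
    qed
    then have "P j u v = (\<Sum>k\<le>j. \<Sum>l\<le>n + k. b k * (-1) ^ (j - k) * (-1) ^ l * of_nat (n + k choose l) * u ^ (j + n - l) * v ^ l)"
      unfolding P_def by (intro sum.cong) auto
    then show ?thesis by (simp add: sum.Sigma case_prod_unfold)
  qed
  note t = test_function_nderiv[OF \<phi>, of r] test_function_nderiv[OF \<phi>, of s]
  show "integrable (lborel \<Otimes>\<^sub>M lborel) (\<lambda>(u, v). of_real (P j u v) * (nderiv r \<phi> u * nderiv s \<phi> v))"
    by (rule integrable_polynomial_tensor[OF t P_eq])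
  show "(\<integral>(u, v). of_real (P j u v) * (nderiv r \<phi> u * nderiv s \<phi> v) \<partial>(lborel \<Otimes>\<^sub>M lborel)) =
    (\<Sum>k\<le>j. \<Sum>l\<le>n + k. of_real (b k * (-1) ^ (j - k) * (-1) ^ l * of_nat (n + k choose l)) *
       (moment (j + n - l) (nderiv r \<phi>) * moment l (nderiv s \<phi>)))"
    unfolding integral_polynomial_tensor[OF t P_eq] by (simp add: sum.Sigma case_prod_unfold)
qed

text \<open>The gluing of the kernels is only valid off the diagonal, which is a null set in each slice.\<close>

lemma integral_AE_offdiagonal:
  fixes f g :: "real \<Rightarrow> real \<Rightarrow> complex"
  assumes f: "integrable (lborel \<Otimes>\<^sub>M lborel) (case_prod f)" and g: "integrable (lborel \<Otimes>\<^sub>M lborel) (case_prod g)"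
    and eq: "\<And>u v. u \<noteq> v \<Longrightarrow> f u v = g u v"
  shows "integral\<^sup>L (lborel \<Otimes>\<^sub>M lborel) (case_prod f) = integral\<^sup>L (lborel \<Otimes>\<^sub>M lborel) (case_prod g)"
proof -
  have "(\<integral>v. f u v \<partial>lborel) = (\<integral>v. g u v \<partial>lborel)" for u
  proof (rule integral_cong_AE)
    note [measurable] = borel_measurable_integrable[OF f] borel_measurable_integrable[OF g]
    have "(\<lambda>v. case_prod f (u, v)) \<in> borel_measurable lborel" "(\<lambda>v. case_prod g (u, v)) \<in> borel_measurable lborel"
      by measurable
    then show "f u \<in> borel_measurable lborel" "g u \<in> borel_measurable lborel" by simp_all
    show "AE v in lborel. f u v = g u v"
      using AE_lborel_singleton[of u] by eventually_elim (use eq in auto)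
  qed
  then show ?thesis
    by (simp add: lborel_pair.integral_fst'[OF f, symmetric] lborel_pair.integral_fst'[OF g, symmetric])
qed

text \<open>The heart of the proof. After Fubini and gluing, the \<open>j\<close>-th moment is the integral of a homogeneous
polynomial of degree \<open>n + j = r + s - (p - j)\<close> against an \<open>r\<close>-th derivative in \<open>u\<close> and an \<open>s\<close>-th derivative
in \<open>v\<close>. A monomial survives only if its degree is at least \<open>r\<close> in \<open>u\<close> and at least \<open>s\<close> in \<open>v\<close>; there is
none for \<open>j < p\<close>, and only \<open>u ^ r * v ^ s\<close> for \<open>j = p\<close>.\<close>

lemma moments_of_glued_product:
  fixes a b :: real
  assumes \<phi>: "\<phi> \<in> test_functions" and \<phi>1: "moment 0 \<phi> = 1"
    and a: "a > -1" and b: "b > -1" and n: "a + b + 1 = real n" and rs: "r + s = n + p"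
  defines "F \<equiv> \<lambda>t. (-1) ^ (p + r) * (corr (nu_plus_fun a) (nderiv r \<phi>) t * corr (nu_minus_fun b) (nderiv s \<phi>) t) +
      (-1) ^ s * (corr (nu_minus_fun a) (nderiv r \<phi>) t * corr (nu_plus_fun b) (nderiv s \<phi>) t)"
  shows "F \<in> test_functions"
    and "j < p \<Longrightarrow> moment j F = 0"
    and "moment p F = of_real ((-1) ^ p * fact p * ((a - real r + real p) gchoose p))"
proof -
  note t = test_function_nderiv[OF \<phi>, of r] test_function_nderiv[OF \<phi>, of s]
  from \<phi> obtain R where "\<And>x. R < \<bar>x\<bar> \<Longrightarrow> \<phi> x = 0"
    by (auto simp: test_function_iff)
  then have R: "R < \<bar>x\<bar> \<Longrightarrow> nderiv m \<phi> x = 0" for m x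
    using nderiv_outside[of R \<phi>] by blast
  note li = loc_integrable_nu_plus loc_integrable_nu_minus
  have T1: "(\<lambda>t. corr (nu_plus_fun a) (nderiv r \<phi>) t * corr (nu_minus_fun b) (nderiv s \<phi>) t) \<in> test_functions"
  proof (rule corr_mult_test_function[OF li(1)[OF a] li(2)[OF b] t])
    show "corr (nu_plus_fun a) (nderiv r \<phi>) x * corr (nu_minus_fun b) (nderiv s \<phi>) x = 0" if "R < \<bar>x\<bar>" for x
      using corr_nu_plus_outside[of R "nderiv r \<phi>" x a] corr_nu_minus_outside[of R "nderiv s \<phi>" x b] R that
      by (cases "x > 0") auto
  qed
  have T2: "(\<lambda>t. corr (nu_minus_fun a) (nderiv r \<phi>) t * corr (nu_plus_fun b) (nderiv s \<phi>) t) \<in> test_functions"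
  proof (rule corr_mult_test_function[OF li(2)[OF a] li(1)[OF b] t])
    show "corr (nu_minus_fun a) (nderiv r \<phi>) x * corr (nu_plus_fun b) (nderiv s \<phi>) x = 0" if "R < \<bar>x\<bar>" for x
      using corr_nu_plus_outside[of R "nderiv s \<phi>" x b] corr_nu_minus_outside[of R "nderiv r \<phi>" x a] R that
      by (cases "x > 0") auto
  qed
  show "F \<in> test_functions"
    unfolding test_function_iff
  proof
    show "smooth F"
      unfolding F_def by (intro smooth_add smooth_cmult test_function_smooth T1 T2)
    obtain R1 where R1: "0 < R1"
      "\<And>x. R1 < \<bar>x\<bar> \<Longrightarrow> corr (nu_plus_fun a) (nderiv r \<phi>) x * corr (nu_minus_fun b) (nderiv s \<phi>) x = 0"
      using T1 unfolding test_function_iff by blast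
    obtain R2 where R2: "0 < R2"
      "\<And>x. R2 < \<bar>x\<bar> \<Longrightarrow> corr (nu_minus_fun a) (nderiv r \<phi>) x * corr (nu_plus_fun b) (nderiv s \<phi>) x = 0"
      using T2 unfolding test_function_iff by blast
    have "F x = 0" if "R1 + R2 < \<bar>x\<bar>" for x
    proof -
      have "R1 < \<bar>x\<bar>" "R2 < \<bar>x\<bar>" using that R1(1) R2(1) by linarith+
      then show ?thesis unfolding F_def by (simp only: R1(2) R2(2)) simp
    qed
    then show "\<exists>R>0. \<forall>x. R < \<bar>x\<bar> \<longrightarrow> F x = 0"
      using R1(1) R2(1) by (intro exI[of _ "R1 + R2"]) simp
  qed
  have moment_F: "moment j F = (-1) ^ (p + r) * 
      (\<Sum>k\<le>j. \<Sum>l\<le>n + k. of_real (real (j choose k) * pochhammer (a + 1) k / fact (n + k) * (-1) ^ (j - k) * (-1) ^ l * of_nat (n + k choose l)) *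
       (moment (j + n - l) (nderiv r \<phi>) * moment l (nderiv s \<phi>)))" for j
  proof -
    define K1 where "K1 = nu_kernel a n j"
    define K2 where "K2 = (\<lambda>u v. (-1) ^ j * nu_kernel a n j (- u) (- v))"
    define G where "G = (\<lambda>u v. nderiv r \<phi> u * nderiv s \<phi> v)"
    define P where "P = (\<lambda>u v. \<Sum>k\<le>j. real (j choose k) * pochhammer (a + 1) k / fact (n + k) * (- u) ^ (j - k) * (u - v) ^ (n + k))"
    have v1: "nu_plus_fun a (t + u) * nu_minus_fun b (t + v) = 0" if "\<bar>u\<bar> \<le> R" "\<bar>v\<bar> \<le> R" "R < \<bar>t\<bar>" for t u v
      using that by (auto simp: nu_plus_fun_def nu_minus_fun_def)
    have v2: "nu_minus_fun a (t + u) * nu_plus_fun b (t + v) = 0" if "\<bar>u\<bar> \<le> R" "\<bar>v\<bar> \<le> R" "R < \<bar>t\<bar>" for t u v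
      using that by (auto simp: nu_plus_fun_def nu_minus_fun_def)
    note A1 = li(1)[OF a] li(2)[OF b] t R R v1 kernel_integral_plus_minus[OF a b n]
    note A2 = li(2)[OF a] li(1)[OF b] t R R v2 kernel_integral_minus_plus[OF a b n]
    have I1: "integrable (lborel \<Otimes>\<^sub>M lborel) (\<lambda>(u, v). of_real (K1 u v) * G u v)"
      and m1: "moment j (\<lambda>t. corr (nu_plus_fun a) (nderiv r \<phi>) t * corr (nu_minus_fun b) (nderiv s \<phi>) t) =
        (\<integral>(u, v). of_real (K1 u v) * G u v \<partial>(lborel \<Otimes>\<^sub>M lborel))"
      unfolding K1_def G_def by (rule integrable_kernel[OF A1] moment_corr_mult[OF A1]; assumption)+
    have I2: "integrable (lborel \<Otimes>\<^sub>M lborel) (\<lambda>(u, v). of_real (K2 u v) * G u v)"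
      and m2: "moment j (\<lambda>t. corr (nu_minus_fun a) (nderiv r \<phi>) t * corr (nu_plus_fun b) (nderiv s \<phi>) t) =
        (\<integral>(u, v). of_real (K2 u v) * G u v \<partial>(lborel \<Otimes>\<^sub>M lborel))"
      unfolding K2_def G_def by (rule integrable_kernel[OF A2] moment_corr_mult[OF A2]; assumption)+
    have sgn: "(-1::complex) ^ s = (-1) ^ (p + r) * (-1) ^ n"
    proof -
      have "even (p + r + n) = even s" using arg_cong[OF rs, of even] by auto
      then show ?thesis unfolding power_add[symmetric] by (simp add: minus_one_power_iff)
    qed
    have i12: "integrable lborel (\<lambda>x. of_real x ^ j * (corr (nu_plus_fun a) (nderiv r \<phi>) x * corr (nu_minus_fun b) (nderiv s \<phi>) x))"
        "integrable lborel (\<lambda>x. of_real x ^ j * (corr (nu_minus_fun a) (nderiv r \<phi>) x * corr (nu_plus_fun b) (nderiv s \<phi>) x))"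
      by (intro test_function_integrable test_function_power_mult T1 T2)+
    have "moment j F = (\<integral>x. (-1) ^ (p + r) * (of_real x ^ j * (corr (nu_plus_fun a) (nderiv r \<phi>) x * corr (nu_minus_fun b) (nderiv s \<phi>) x)) +
       (-1) ^ s * (of_real x ^ j * (corr (nu_minus_fun a) (nderiv r \<phi>) x * corr (nu_plus_fun b) (nderiv s \<phi>) x)) \<partial>lborel)"
      unfolding moment_def F_def by (intro Bochner_Integration.integral_cong) (simp_all add: distrib_left mult_ac)
    also have "\<dots> = (-1) ^ (p + r) * moment j (\<lambda>t. corr (nu_plus_fun a) (nderiv r \<phi>) t * corr (nu_minus_fun b) (nderiv s \<phi>) t) +
       (-1) ^ s * moment j (\<lambda>t. corr (nu_minus_fun a) (nderiv r \<phi>) t * corr (nu_plus_fun b) (nderiv s \<phi>) t)"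
      unfolding moment_def using i12 by simp
    also have "\<dots> = (-1) ^ (p + r) * ((\<integral>(u, v). of_real (K1 u v) * G u v \<partial>(lborel \<Otimes>\<^sub>M lborel)) +
        (-1) ^ n * (\<integral>(u, v). of_real (K2 u v) * G u v \<partial>(lborel \<Otimes>\<^sub>M lborel)))"
      unfolding m1 m2 sgn by (simp add: distrib_left)
    also have "(\<integral>(u, v). of_real (K1 u v) * G u v \<partial>(lborel \<Otimes>\<^sub>M lborel)) +
        (-1) ^ n * (\<integral>(u, v). of_real (K2 u v) * G u v \<partial>(lborel \<Otimes>\<^sub>M lborel)) =
        (\<integral>(u, v). of_real (K1 u v) * G u v + (-1) ^ n * (of_real (K2 u v) * G u v) \<partial>(lborel \<Otimes>\<^sub>M lborel))"
      using I1 I2 by (simp add: case_prod_unfold)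
    also have "\<dots> = (\<integral>(u, v). of_real (P u v) * G u v \<partial>(lborel \<Otimes>\<^sub>M lborel))"
    proof (rule integral_AE_offdiagonal)
      show "integrable (lborel \<Otimes>\<^sub>M lborel) (\<lambda>(u, v). of_real (K1 u v) * G u v + (-1) ^ n * (of_real (K2 u v) * G u v))"
        using I1 I2 by (simp add: case_prod_unfold)
      show "integrable (lborel \<Otimes>\<^sub>M lborel) (\<lambda>(u, v). of_real (P u v) * G u v)"
        unfolding P_def G_def by (rule integral_glued_polynomial(2)[OF \<phi>])
      fix u v :: real assume "u \<noteq> v"
      have K12: "K1 u v + (-1) ^ n * K2 u v = P u v"
        unfolding K1_def K2_def P_def kernel_glue[OF \<open>u \<noteq> v\<close>] by (intro sum.cong) auto
      have "of_real (P u v) = of_real (K1 u v) + (-1) ^ n * (of_real (K2 u v) :: complex)"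
        unfolding K12[symmetric] by simp
      then show "of_real (K1 u v) * G u v + (-1) ^ n * (of_real (K2 u v) * G u v) = of_real (P u v) * G u v"
        by (simp add: distrib_right)
    qed
    finally show ?thesis
      unfolding P_def G_def integral_glued_polynomial(1)[OF \<phi>] .
  qed
  show "moment j F = 0" if "j < p"
  proof -
    have "moment (j + n - l) (nderiv r \<phi>) * moment l (nderiv s \<phi>) = 0"
      if "k \<le> j" "l \<le> n + k" for k l
    proof (cases "l < s")
      case False
      then have "j + n - l < r" using that rs \<open>j < p\<close> by linarith
      then show ?thesis using moment_nderiv(1)[OF \<phi>] by simp
    qed (use moment_nderiv(1)[OF \<phi>] in simp)
    then have zero: "(\<Sum>l\<le>n + k. c l * (moment (j + n - l) (nderiv r \<phi>) * moment l (nderiv s \<phi>))) = 0"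
      if "k \<le> j" for k and c :: "nat \<Rightarrow> complex"
      using that by (intro sum.neutral) simp
    have "moment j F = (-1) ^ (p + r) * (\<Sum>k\<le>j. 0)"
      unfolding moment_F by (intro arg_cong2[of _ _ _ _ "(*)"] sum.cong refl zero) simp
    then show ?thesis by simp
  qed
  have inner: "(\<Sum>l\<le>n + k. of_real (real (p choose k) * pochhammer (a + 1) k / fact (n + k) * (-1) ^ (p - k) * (-1) ^ l * of_nat (n + k choose l)) *
       (moment (p + n - l) (nderiv r \<phi>) * moment l (nderiv s \<phi>))) =
     of_real ((-1) ^ (p + r) * (real (p choose k) * (-1) ^ k * pochhammer (a + 1) k * (fact (p - k) * real (r choose (p - k)))))"
    if "k \<le> p" for k
  proof -
    define d where "d l = real (p choose k) * pochhammer (a + 1) k / fact (n + k) * (-1) ^ (p - k) * (-1) ^ l * of_nat (n + k choose l)" for l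
    \<comment> \<open>only the monomial \<open>u ^ r * v ^ s\<close> contributes\<close>
    have mm: "moment (p + n - l) (nderiv r \<phi>) * moment l (nderiv s \<phi>) =
        (if l = s then of_real ((-1) ^ r * fact r * ((-1) ^ s * fact s)) else 0)"
      if "l \<in> {..n + k}" for l
    proof (cases l s rule: linorder_cases)
      case greater
      then have "p + n - l < r" using rs \<open>k \<le> p\<close> that by simp
      then show ?thesis using greater moment_nderiv(1)[OF \<phi>] by simp
    next
      case equal
      have "p + n - s = r" using rs by auto
      then show ?thesis using moment_nderiv(2)[OF \<phi>] \<phi>1 equal by simp
    qed (use moment_nderiv(1)[OF \<phi>] in simp)
    have "(\<Sum>l\<le>n + k. of_real (d l) * (moment (p + n - l) (nderiv r \<phi>) * moment l (nderiv s \<phi>))) =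
        (\<Sum>l\<le>n + k. of_real (d l) * (if l = s then of_real ((-1) ^ r * fact r * ((-1) ^ s * fact s)) else 0))"
      by (intro sum.cong refl arg_cong2[of _ _ _ _ "(*)"] mm)
    also have "\<dots> = (if s \<le> n + k then of_real (d s * ((-1) ^ r * fact r * ((-1) ^ s * fact s))) else 0)"
      by (simp add: if_distrib[of "\<lambda>x. _ * x"] cong: if_cong)
    also have "\<dots> = of_real (if s \<le> n + k then d s * ((-1) ^ r * fact r * ((-1) ^ s * fact s)) else 0)"
      by simp
    also have "(if s \<le> n + k then d s * ((-1) ^ r * fact r * ((-1) ^ s * fact s)) else 0) =
        (real (p choose k) * pochhammer (a + 1) k * ((-1) ^ (p - k) * (-1) ^ r)) * 
        (if s \<le> n + k then real (n + k choose s) * fact s * fact r / fact (n + k) else 0)"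
      by (simp add: d_def mult_ac flip: power_mult_distrib)
    also have "\<dots> = (real (p choose k) * pochhammer (a + 1) k * ((-1) ^ (p - k) * (-1) ^ r)) * (fact (p - k) * real (r choose (p - k)))"
      unfolding choose_times_fact[OF rs that] ..
    also have "(-1::real) ^ (p - k) * (-1) ^ r = (-1) ^ (p + r) * (-1) ^ k"
      unfolding power_add[symmetric] using that by (simp add: minus_one_power_iff)
    finally show ?thesis unfolding d_def by (simp only: mult_ac)
  qed
  have "moment p F = (-1) ^ (p + r) * (\<Sum>k\<le>p. of_real ((-1) ^ (p + r) * (real (p choose k) * (-1) ^ k * pochhammer (a + 1) k * (fact (p - k) * real (r choose (p - k))))))"
    unfolding moment_F using inner by (intro arg_cong2[of _ _ _ _ "(*)"] sum.cong refl) blast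
  also have "\<dots> = of_real ((-1) ^ (p + r) * (\<Sum>k\<le>p. (-1) ^ (p + r) * (real (p choose k) * (-1) ^ k * pochhammer (a + 1) k * (fact (p - k) * real (r choose (p - k))))))"
    by simp
  also have "(-1) ^ (p + r) * (\<Sum>k\<le>p. (-1) ^ (p + r) * (real (p choose k) * (-1) ^ k * pochhammer (a + 1) k * (fact (p - k) * real (r choose (p - k))))) =
     (\<Sum>k\<le>p. real (p choose k) * (-1) ^ k * pochhammer (a + 1) k * (fact (p - k) * real (r choose (p - k))))"
    unfolding sum_distrib_left[symmetric] by (rule left_minus_one_mult_self)
  also have "\<dots> = (-1) ^ p * fact p * ((a - real r + real p) gchoose p)"
    by (rule vandermonde_pochhammer) simp
  finally show "moment p F = of_real ((-1) ^ p * fact p * ((a - real r + real p) gchoose p))" .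
qed

section \<open>Convergence to a derivative of the Dirac distribution\<close>

lemma bdd_test_function: "\<psi> \<in> test_functions \<Longrightarrow> bdd_above (range (\<lambda>x. norm (\<psi> x)))"
  by (erule test_function_bounded) (rule bdd_aboveI2)

lemma dirac_deriv_distribution:
  "(\<lambda>\<psi>. c * (dist_deriv ^^ p) dirac \<psi>) \<in> distributions"
proof -
  let ?u = "\<lambda>\<psi>. c * (dist_deriv ^^ p) dirac \<psi>"
  have u: "?u \<psi> = c * (-1) ^ p * nderiv p \<psi> 0" for \<psi>
    by (simp add: dist_deriv_power dirac_def)
  have bound: "norm (?u \<psi>) \<le> norm c * (\<Sum>m\<le>p. SUP x. norm (nderiv m \<psi> x))" if "\<psi> \<in> test_functions" for \<psi>
  proof -
    have bdd: "bdd_above (range (\<lambda>x. norm (nderiv m \<psi> x)))" for m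
      by (intro bdd_test_function test_function_nderiv that)
    have nonneg: "0 \<le> (SUP x. norm (nderiv m \<psi> x))" for m
      using cSUP_upper2[OF bdd, of 0 0] by simp
    have "norm (nderiv p \<psi> 0) \<le> (SUP x. norm (nderiv p \<psi> x))"
      by (rule cSUP_upper[OF _ bdd]) simp
    also have "\<dots> \<le> (\<Sum>m\<le>p. SUP x. norm (nderiv m \<psi> x))"
      using nonneg by (intro member_le_sum) auto
    finally have "norm c * norm (nderiv p \<psi> 0) \<le> norm c * (\<Sum>m\<le>p. SUP x. norm (nderiv m \<psi> x))"
      by (intro mult_left_mono) auto
    then show ?thesis by (simp add: u norm_mult norm_power)
  qed
  show ?thesis
    unfolding distributions_def
  proof (intro CollectI conjI ballI allI impI)
    fix \<phi> \<psi> assume "\<phi> \<in> test_functions" "\<psi> \<in> test_functions"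
    then show "?u (\<lambda>x. \<phi> x + \<psi> x) = ?u \<phi> + ?u \<psi>"
      unfolding u by (simp add: nderiv_add test_function_smooth distrib_left)
  next
    fix d \<phi> assume "\<phi> \<in> test_functions"
    then show "?u (\<lambda>x. d * \<phi> x) = d * ?u \<phi>"
      unfolding u by (simp add: nderiv_cmult test_function_smooth)
  qed (use bound in blast)
qed

text \<open>A scaled test function \<open>\<epsilon> ^ -(p + 1) * F (x / \<epsilon>)\<close> whose moments of order less than \<open>p\<close> vanish converges to a
multiple of \<open>\<delta>\<^sup>(\<^sup>p\<^sup>)\<close>: in the Taylor expansion of \<open>\<psi>\<close> the term of order \<open>j\<close> is multiplied by \<open>\<epsilon> ^ (j - p)\<close>
times the \<open>j\<close>-th moment, and the remainder is \<open>O(\<epsilon>)\<close>.\<close>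

lemma rescaled_test_integral_limit:
  assumes F: "F \<in> test_functions" and \<psi>: "\<psi> \<in> test_functions"
    and M0: "\<And>j. j < p \<Longrightarrow> moment j F = 0" and Mp: "moment p F = fact p * L"
  shows "((\<lambda>\<epsilon>. \<integral>x. of_real (1 / \<epsilon> ^ (p + 1)) * F (x / \<epsilon>) * \<psi> x \<partial>lborel) \<longlongrightarrow> L * nderiv p \<psi> 0) (at_right 0)"
proof -
  define T where "T x = (\<Sum>j\<le>p. nderiv j \<psi> 0 * of_real (x ^ j / fact j))" for x
  obtain B where B: "B > 0" "\<And>x. norm (nderiv (Suc p) \<psi> x) \<le> B"
    using test_function_bounded[OF test_function_nderiv[OF \<psi>]] by blast
  have taylor: "norm (\<psi> x - T x) \<le> B * \<bar>x\<bar> ^ Suc p" for x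
    unfolding T_def by (rule taylor_bound[OF test_function_smooth[OF \<psi>] B(2)])
  note [measurable] = test_function_measurable[OF F] test_function_measurable[OF \<psi>]
  have iF: "integrable lborel (\<lambda>t. of_real t ^ j * F t)" for j
    by (intro test_function_integrable test_function_power_mult F)
  define C where "C = B * (\<integral>t. norm (of_real t ^ Suc p * F t) \<partial>lborel)"
  have est: "norm ((\<integral>x. of_real (1 / \<epsilon> ^ (p + 1)) * F (x / \<epsilon>) * \<psi> x \<partial>lborel) - L * nderiv p \<psi> 0) \<le> C * \<epsilon>"
    if \<epsilon>: "\<epsilon> > 0" for \<epsilon>
  proof -
    have T_int: "(\<integral>t. F t * T (\<epsilon> * t) \<partial>lborel) = of_real (\<epsilon> ^ p) * (L * nderiv p \<psi> 0)"
      and iT: "integrable lborel (\<lambda>t. F t * T (\<epsilon> * t))"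
    proof -
      have eq: "F t * T (\<epsilon> * t) = (\<Sum>j\<le>p. nderiv j \<psi> 0 * of_real (\<epsilon> ^ j / fact j) * (of_real t ^ j * F t))" for t
        unfolding T_def sum_distrib_left by (simp add: power_mult_distrib mult_ac)
      show "integrable lborel (\<lambda>t. F t * T (\<epsilon> * t))"
        unfolding eq by (intro Bochner_Integration.integrable_sum integrable_mult_right iF)
      have "(\<integral>t. F t * T (\<epsilon> * t) \<partial>lborel) = (\<Sum>j\<le>p. nderiv j \<psi> 0 * of_real (\<epsilon> ^ j / fact j) * moment j F)"
        unfolding eq moment_def
        by (subst Bochner_Integration.integral_sum) (intro integrable_mult_right iF, simp)
      also have "\<dots> = nderiv p \<psi> 0 * of_real (\<epsilon> ^ p / fact p) * moment p F"
        unfolding lessThan_Suc_atMost[symmetric] by (simp add: M0)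
      finally show "(\<integral>t. F t * T (\<epsilon> * t) \<partial>lborel) = of_real (\<epsilon> ^ p) * (L * nderiv p \<psi> 0)"
        by (simp add: Mp)
    qed
    obtain B0 where B0: "\<And>x. norm (\<psi> x) \<le> B0" using test_function_bounded[OF \<psi>] by blast
    have i\<psi>: "integrable lborel (\<lambda>t. F t * \<psi> (\<epsilon> * t))"
    proof (rule Bochner_Integration.integrable_bound)
      show "integrable lborel (\<lambda>t. of_real B0 * F t)"
        by (intro integrable_mult_right test_function_integrable F)
      have "norm (F t * \<psi> (\<epsilon> * t)) \<le> norm (of_real B0 * F t)" for t
      proof -
        have "norm (\<psi> (\<epsilon> * t)) \<le> \<bar>B0\<bar>" using B0[of "\<epsilon> * t"] by linarith
        then show ?thesis
          using mult_right_mono[of "norm (\<psi> (\<epsilon> * t))" "\<bar>B0\<bar>" "norm (F t)"] by (simp add: norm_mult mult.commute)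
      qed
      then show "AE t in lborel. norm (F t * \<psi> (\<epsilon> * t)) \<le> norm (of_real B0 * F t)" by simp
    qed measurable
    have "(\<integral>x. of_real (1 / \<epsilon> ^ (p + 1)) * F (x / \<epsilon>) * \<psi> x \<partial>lborel) =
        of_real \<epsilon> * (\<integral>t. of_real (1 / \<epsilon> ^ (p + 1)) * (F t * \<psi> (\<epsilon> * t)) \<partial>lborel)"
      using \<epsilon> by (subst lborel_integral_real_affine[of \<epsilon> _ 0]) (simp_all add: scaleR_conv_of_real mult.assoc)
    also have "\<dots> = of_real (\<epsilon> * (1 / \<epsilon> ^ (p + 1))) * (\<integral>t. F t * \<psi> (\<epsilon> * t) \<partial>lborel)"
      by (simp only: integral_mult_right_zero of_real_mult mult.assoc)
    also have "\<epsilon> * (1 / \<epsilon> ^ (p + 1)) = 1 / \<epsilon> ^ p"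
      using \<epsilon> by simp
    finally have "(\<integral>x. of_real (1 / \<epsilon> ^ (p + 1)) * F (x / \<epsilon>) * \<psi> x \<partial>lborel) - L * nderiv p \<psi> 0 =
        of_real (1 / \<epsilon> ^ p) * ((\<integral>t. F t * \<psi> (\<epsilon> * t) \<partial>lborel) - (\<integral>t. F t * T (\<epsilon> * t) \<partial>lborel))"
      unfolding T_int using \<epsilon> by (simp add: field_simps)
    also have "\<dots> = of_real (1 / \<epsilon> ^ p) * (\<integral>t. F t * \<psi> (\<epsilon> * t) - F t * T (\<epsilon> * t) \<partial>lborel)"
      using i\<psi> iT by simp
    finally have eq: "(\<integral>x. of_real (1 / \<epsilon> ^ (p + 1)) * F (x / \<epsilon>) * \<psi> x \<partial>lborel) - L * nderiv p \<psi> 0 =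
        of_real (1 / \<epsilon> ^ p) * (\<integral>t. F t * \<psi> (\<epsilon> * t) - F t * T (\<epsilon> * t) \<partial>lborel)" .
    have "norm (\<integral>t. F t * \<psi> (\<epsilon> * t) - F t * T (\<epsilon> * t) \<partial>lborel) \<le>
        (\<integral>t. norm (F t * \<psi> (\<epsilon> * t) - F t * T (\<epsilon> * t)) \<partial>lborel)"
      by (rule integral_norm_bound)
    also have "\<dots> \<le> (\<integral>t. B * \<epsilon> ^ Suc p * norm (of_real t ^ Suc p * F t) \<partial>lborel)"
    proof (rule integral_mono)
      show "integrable lborel (\<lambda>t. norm (F t * \<psi> (\<epsilon> * t) - F t * T (\<epsilon> * t)))"
        using i\<psi> iT by (intro integrable_norm Bochner_Integration.integrable_diff)
      show "integrable lborel (\<lambda>t. B * \<epsilon> ^ Suc p * norm (of_real t ^ Suc p * F t))"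
        by (intro integrable_mult_right integrable_norm iF)
      fix t
      have "norm (F t * \<psi> (\<epsilon> * t) - F t * T (\<epsilon> * t)) = norm (F t) * norm (\<psi> (\<epsilon> * t) - T (\<epsilon> * t))"
        by (simp flip: right_diff_distrib norm_mult)
      also have "\<dots> \<le> norm (F t) * (B * \<bar>\<epsilon> * t\<bar> ^ Suc p)"
        by (intro mult_left_mono taylor) simp
      also have "\<dots> = B * \<epsilon> ^ Suc p * norm (of_real t ^ Suc p * F t)"
        unfolding abs_mult power_mult_distrib norm_mult norm_power norm_of_real using \<epsilon> by (simp only: abs_of_pos mult_ac)
      finally show "norm (F t * \<psi> (\<epsilon> * t) - F t * T (\<epsilon> * t)) \<le> B * \<epsilon> ^ Suc p * norm (of_real t ^ Suc p * F t)" .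
    qed
    also have "\<dots> = C * \<epsilon> ^ Suc p"
      unfolding C_def integral_mult_right_zero by (simp only: mult_ac)
    finally have "(1 / \<epsilon> ^ p) * norm (\<integral>t. F t * \<psi> (\<epsilon> * t) - F t * T (\<epsilon> * t) \<partial>lborel) \<le> (1 / \<epsilon> ^ p) * (C * \<epsilon> ^ Suc p)"
      using \<epsilon> by (intro mult_left_mono) auto
    then show ?thesis
      unfolding eq norm_mult norm_of_real using \<epsilon> by (simp add: mult.commute)
  qed
  have "((\<lambda>\<epsilon>. (\<integral>x. of_real (1 / \<epsilon> ^ (p + 1)) * F (x / \<epsilon>) * \<psi> x \<partial>lborel) - L * nderiv p \<psi> 0) \<longlongrightarrow> 0) (at_right 0)"
  proof (rule Lim_null_comparison)
    show "\<forall>\<^sub>F \<epsilon> in at_right 0. norm ((\<integral>x. of_real (1 / \<epsilon> ^ (p + 1)) * F (x / \<epsilon>) * \<psi> x \<partial>lborel) - L * nderiv p \<psi> 0) \<le> C * \<epsilon>"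
      by (rule eventually_mono[OF eventually_at_right_0_pos]) (use est in blast)
    show "((\<lambda>\<epsilon>. C * \<epsilon>) \<longlongrightarrow> 0) (at_right 0)"
      by (rule tendsto_eq_intros refl | simp)+
  qed
  then show ?thesis by (simp only: LIM_zero_iff)
qed

theorem theorem4:
  fixes a :: real and p :: nat
  assumes "a \<notin> \<int>" and "p \<ge> 1"
  shows "([((-1 :: int) ^ p)] \<cdot>\<^bsub>colombeau\<^esub>
            (colombeau_embed (nu_plus a) \<otimes>\<^bsub>colombeau\<^esub> colombeau_embed (nu_minus (- a - real p - 1))))
          \<oplus>\<^bsub>colombeau\<^esub>
         (colombeau_embed (nu_minus a) \<otimes>\<^bsub>colombeau\<^esub> colombeau_embed (nu_plus (- a - real p - 1)))
       \<approx>\<^sub>D (\<lambda>\<psi>. complex_of_real ((a + real p) gchoose p) * (dist_deriv ^^ p) dirac \<psi>)"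
proof -
  define b where "b = - a - real p - 1"
  define r where "r = nu_order a"
  define s where "s = nu_order b"
  \<comment> \<open>exponents of locally integrable functions, of which the given distributions are derivatives\<close>
  define a' where "a' = a + real r"
  define b' where "b' = b + real s"
  define n where "n = r + s - p"
  have a': "a' > -1" and b': "b' > -1"
    unfolding a'_def b'_def r_def s_def by (rule nu_order)+
  have ab: "a' + b' + 1 = real r + real s - real p"
    by (simp add: a'_def b'_def b_def)
  with a' b' have "real (r + s) > real p - 1" by simp
  then have "p \<le> r + s" by linarith
  then have rs: "r + s = n + p" and n: "a' + b' + 1 = real n"
    using ab by (simp_all add: n_def of_nat_diff)
  define A where "A = (\<lambda>\<phi>. dist_convolution (nu_plus a) (\<lambda>y. \<phi> (- y)))"
  define B where "B = (\<lambda>\<phi>. dist_convolution (nu_minus b) (\<lambda>y. \<phi> (- y)))"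
  define C where "C = (\<lambda>\<phi>. dist_convolution (nu_minus a) (\<lambda>y. \<phi> (- y)))"
  define D where "D = (\<lambda>\<phi>. dist_convolution (nu_plus b) (\<lambda>y. \<phi> (- y)))"
  define f where "f = (\<lambda>\<phi> x. (-1) ^ p * (A \<phi> x * B \<phi> x) + C \<phi> x * D \<phi> x)"
  have mod: "A \<in> E_moderate" "B \<in> E_moderate" "C \<in> E_moderate" "D \<in> E_moderate"
    unfolding A_def B_def C_def D_def
    by (rule convolution_nu_plus_moderate convolution_nu_minus_moderate)+
  then have f: "f \<in> E_moderate"
    unfolding f_def by (intro E_moderate_add E_moderate_cmult E_moderate_mult)
  interpret hom: ring_hom_cring moderate_ring colombeau "(+>\<^bsub>moderate_ring\<^esub>) E_null"
    by (rule colombeau_hom)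
  interpret I: ideal E_null moderate_ring by (rule E_null_ideal)
  have lhs: "([((-1 :: int) ^ p)] \<cdot>\<^bsub>colombeau\<^esub>
            (colombeau_embed (nu_plus a) \<otimes>\<^bsub>colombeau\<^esub> colombeau_embed (nu_minus b)))
          \<oplus>\<^bsub>colombeau\<^esub>
         (colombeau_embed (nu_minus a) \<otimes>\<^bsub>colombeau\<^esub> colombeau_embed (nu_plus b))
      = E_null +>\<^bsub>moderate_ring\<^esub> f"
    using colombeau_combination[OF mod, of p]
    by (simp add: colombeau_embed_def f_def A_def B_def C_def D_def)
  have lim: "((\<lambda>\<epsilon>. \<integral>x. f (rescale \<epsilon> \<phi>) x * \<psi> x \<partial>lborel) \<longlongrightarrow>
      complex_of_real ((a + real p) gchoose p) * (dist_deriv ^^ p) dirac \<psi>) (at_right 0)"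
    if \<psi>: "\<psi> \<in> test_functions" and \<phi>0: "\<phi> \<in> A_space 0" for \<psi> \<phi>
  proof -
    have \<phi>: "\<phi> \<in> test_functions" and \<phi>1: "moment 0 \<phi> = 1"
      using \<phi>0 by (auto simp: A_space_def moment_def)
    note sm = test_function_smooth[OF \<phi>]
    define F where "F = (\<lambda>t. (-1) ^ (p + r) * (corr (nu_plus_fun a') (nderiv r \<phi>) t * corr (nu_minus_fun b') (nderiv s \<phi>) t) +
      (-1) ^ s * (corr (nu_minus_fun a') (nderiv r \<phi>) t * corr (nu_plus_fun b') (nderiv s \<phi>) t))"
    \<comment> \<open>the product at scale \<open>\<epsilon> = 1\<close>, with the distributional derivatives moved to \<open>\<phi>\<close>\<close>
    note F = moments_of_glued_product[OF \<phi> \<phi>1 a' b' n rs, folded F_def]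
    have "f (rescale \<epsilon> \<phi>) x = of_real (1 / \<epsilon> ^ (p + 1)) * F (x / \<epsilon>)" if \<epsilon>: "\<epsilon> > 0" for \<epsilon> x
    proof -
      note conv = convolution_nu_plus[OF rescale_test_function[OF \<phi> \<epsilon>]] convolution_nu_minus[OF rescale_test_function[OF \<phi> \<epsilon>]]
      have scale: "corr (nu_plus_fun c) (nderiv m (rescale \<epsilon> \<phi>)) y =
          of_real (\<epsilon> powr (c - real m)) * corr (nu_plus_fun c) (nderiv m \<phi>) (y / \<epsilon>)"
        "corr (nu_minus_fun c) (nderiv m (rescale \<epsilon> \<phi>)) y =
          of_real (\<epsilon> powr (c - real m)) * corr (nu_minus_fun c) (nderiv m \<phi>) (y / \<epsilon>)" for c m y
        by (rule corr_rescale[OF \<epsilon> sm] nu_plus_fun_scale[OF \<epsilon>] nu_minus_fun_scale[OF \<epsilon>])+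
      have "a' - real r = a" "b' - real s = b" by (simp_all add: a'_def b'_def)
      have vals: "A (rescale \<epsilon> \<phi>) x = (-1) ^ r * (of_real (\<epsilon> powr a) * corr (nu_plus_fun a') (nderiv r \<phi>) (x / \<epsilon>))"
        "B (rescale \<epsilon> \<phi>) x = of_real (\<epsilon> powr b) * corr (nu_minus_fun b') (nderiv s \<phi>) (x / \<epsilon>)"
        "C (rescale \<epsilon> \<phi>) x = of_real (\<epsilon> powr a) * corr (nu_minus_fun a') (nderiv r \<phi>) (x / \<epsilon>)"
        "D (rescale \<epsilon> \<phi>) x = (-1) ^ s * (of_real (\<epsilon> powr b) * corr (nu_plus_fun b') (nderiv s \<phi>) (x / \<epsilon>))"
        unfolding A_def B_def C_def D_def conv r_def[symmetric] s_def[symmetric] a'_def[symmetric] b'_def[symmetric]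
          scale \<open>a' - real r = a\<close> \<open>b' - real s = b\<close> by simp_all
      have "\<epsilon> powr a * \<epsilon> powr b = 1 / \<epsilon> ^ (p + 1)"
      proof -
        have "\<epsilon> powr a * \<epsilon> powr b = \<epsilon> powr (- real (p + 1))"
          unfolding powr_add[symmetric] b_def by (simp add: algebra_simps)
        then show ?thesis
          using \<epsilon> by (simp only: powr_minus powr_realpow inverse_eq_divide)
      qed
      then have pw: "of_real (1 / \<epsilon> ^ (p + 1)) = (of_real (\<epsilon> powr a) * of_real (\<epsilon> powr b) :: complex)"
        by (simp only: of_real_mult[symmetric])
      show ?thesis
        unfolding f_def vals pw F_def by (simp add: algebra_simps power_add)
    qed
    then have ev: "\<forall>\<^sub>F \<epsilon> in at_right 0. (\<integral>x. of_real (1 / \<epsilon> ^ (p + 1)) * F (x / \<epsilon>) * \<psi> x \<partial>lborel) =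
        (\<integral>x. f (rescale \<epsilon> \<phi>) x * \<psi> x \<partial>lborel)"
      by (intro eventually_mono[OF eventually_at_right_0_pos]) simp
    have "moment p F = fact p * ((-1) ^ p * complex_of_real ((a + real p) gchoose p))"
      unfolding F(3) by (simp add: a'_def)
    from rescaled_test_integral_limit[OF F(1) \<psi> F(2) this]
    have "((\<lambda>\<epsilon>. \<integral>x. f (rescale \<epsilon> \<phi>) x * \<psi> x \<partial>lborel) \<longlongrightarrow>
        (-1) ^ p * complex_of_real ((a + real p) gchoose p) * nderiv p \<psi> 0) (at_right 0)"
      using ev by (rule Lim_transform_eventually)
    then show ?thesis by (simp add: dist_deriv_power dirac_def mult_ac)
  qed
  have "E_null +>\<^bsub>moderate_ring\<^esub> f \<in> carrier colombeau"
    using f by (intro hom.hom_closed) simp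
  moreover have "f \<in> E_null +>\<^bsub>moderate_ring\<^esub> f"
    using f by (intro I.a_rcos_self) simp
  ultimately show ?thesis
    unfolding b_def[symmetric] lhs associated_def using lim dirac_deriv_distribution by blast
qed

end
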